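(* Let $R$ be a commutative semiring. The functor $\mathrm{sSet}(-,-):\mathrm{sSet}^{op}\times\mathrm{sSet}\to\mathrm{Set}$ restricts to a functor $$\mathrm{sSet}(-,-):\mathrm{sSet}^{op}\times s\mathrm{ConvMon}_R\to\mathrm{ConvMon}_R,$$ where, for a simplicial set $X$ and a simplicial $R$-convex monoid $Y$, $\mathrm{sSet}(X,Y)$ carries the pointwise product and the structure map $\pi^{\mathrm{sSet}(X,Y)}=(\pi^Y)_*\circ\Theta_{X,Y}$. In particular, for a simplicial set $X$ and a simplicial monoid $Y$, the set $\mathrm{sSet}(X,D_R(Y))$ is an $R$-convex monoid.
   Context: For a set $S$, $D_R(S)$ is the set of functions $p:S\to R$ of finite support with $\sum_s p(s)=1$; for $f:S\to T$, $D_R(f)(p)(t)=\sum_{f(s)=t}p(s)$. It is a monad on $\mathrm{Set}$ with unit $\delta_S(s)=\delta^s$ (delta distribution) and multiplication $\mu_S(P)(s)=\sum_pP(p)p(s)$. If $M$ is a monoid, $D_R(M)$ is a monoid under $(p*q)(m)=\sum_{ab=m}p(a)q(b)$ with unit $\delta^{e}$, and $D_R$ is thereby a monad on the category of monoids. An $R$-convex monoid is an algebra over this monad: a monoid $M$ with a monoid homomorphism $\pi^M:D_R(M)\to M$ such that $\pi^M\circ\delta_M=\mathrm{Id}$ and $\pi^M\circ D_R(\pi^M)=\pi^M\circ\mu_M$. Morphisms are monoid homomorphisms $f$ with $\pi\circ D_R(f)=f\circ\pi$. The category of $R$-convex monoids is $\mathrm{ConvMon}_R$, and $s\mathrm{ConvMon}_R$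 is the category of its simplicial objects. For a simplicial set $Y$, $D_R(Y)$ is obtained by applying $D_R$ degreewise; for $Y$ a simplicial $R$-convex monoid, $\pi^Y:D_R(Y)\to Y$ is the simplicial map given degreewise by the structure maps. For a simplicial monoid $Y$, $D_R(Y)$ is a simplicial $R$-convex monoid with degreewise product $*$ and structure map $\mu$. For simplicial sets $X,Y$, $\Theta_{X,Y}:D_R(\mathrm{sSet}(X,Y))\to\mathrm{sSet}(X,D_R(Y))$ is $\Theta_{X,Y}(d)_n(x)=\sum_{\varphi}d(\varphi)\delta^{\varphi_n(x)}$. *)

theory Defs
  imports "HOL-Algebra.Group"
begin

section \<open>Categories and functors\<close>

text \<open>
  Hom-sets for different pairs of objects need not be disjoint, so composition and the arrow
  part of a functor take the objects involved as arguments: \<open>Comp C A B D g f\<close> is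
  \<open>g \<circ> f\<close> for \<open>f : A \<rightarrow> B\<close> and \<open>g : B \<rightarrow> D\<close>.
\<close>

record ('o, 'm) category =
  Obj :: "'o set"
  Hom :: "'o \<Rightarrow> 'o \<Rightarrow> 'm set"
  Ident :: "'o \<Rightarrow> 'm"
  Comp :: "'o \<Rightarrow> 'o \<Rightarrow> 'o \<Rightarrow> 'm \<Rightarrow> 'm \<Rightarrow> 'm"

locale category =
  fixes C :: "('o, 'm) category"
  assumes Ident_in_Hom: "A \<in> Obj C \<Longrightarrow> Ident C A \<in> Hom C A A"
    and Comp_in_Hom:
      "\<lbrakk>A \<in> Obj C; B \<in> Obj C; D \<in> Obj C; f \<in> Hom C A B; g \<in> Hom C B D\<rbrakk>
        \<Longrightarrow> Comp C A B D g f \<in> Hom C A D"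
    and Comp_Ident_right:
      "\<lbrakk>A \<in> Obj C; B \<in> Obj C; f \<in> Hom C A B\<rbrakk> \<Longrightarrow> Comp C A A B f (Ident C A) = f"
    and Comp_Ident_left:
      "\<lbrakk>A \<in> Obj C; B \<in> Obj C; f \<in> Hom C A B\<rbrakk> \<Longrightarrow> Comp C A B B (Ident C B) f = f"
    and Comp_assoc:
      "\<lbrakk>A \<in> Obj C; B \<in> Obj C; D \<in> Obj C; E \<in> Obj C;
        f \<in> Hom C A B; g \<in> Hom C B D; h \<in> Hom C D E\<rbrakk>
        \<Longrightarrow> Comp C A D E h (Comp C A B D g f) = Comp C A B E (Comp C B D E h g) f"

record ('o1, 'm1, 'o2, 'm2) functr =
  fob :: "'o1 \<Rightarrow> 'o2"
  far :: "'o1 \<Rightarrow> 'o1 \<Rightarrow> 'm1 \<Rightarrow> 'm2"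

locale is_functor = src: category C + tgt: category D
  for C :: "('o1, 'm1) category" and D :: "('o2, 'm2) category" +
  fixes F :: "('o1, 'm1, 'o2, 'm2) functr"
  assumes fob_in_Obj: "A \<in> Obj C \<Longrightarrow> fob F A \<in> Obj D"
    and far_in_Hom:
      "\<lbrakk>A \<in> Obj C; B \<in> Obj C; f \<in> Hom C A B\<rbrakk> \<Longrightarrow> far F A B f \<in> Hom D (fob F A) (fob F B)"
    and far_Ident: "A \<in> Obj C \<Longrightarrow> far F A A (Ident C A) = Ident D (fob F A)"
    and far_Comp:
      "\<lbrakk>A \<in> Obj C; B \<in> Obj C; E \<in> Obj C; f \<in> Hom C A B; g \<in> Hom C B E\<rbrakk>
        \<Longrightarrow> far F A E (Comp C A B E g f)
            = Comp D (fob F A) (fob F B) (fob F E) (far F B E g) (far F A B f)"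

definition opposite :: "('o, 'm) category \<Rightarrow> ('o, 'm) category" where
  "opposite C = \<lparr>Obj = Obj C, Hom = \<lambda>A B. Hom C B A, Ident = Ident C,
     Comp = \<lambda>A B D g f. Comp C D B A f g\<rparr>"

definition prod_category ::
    "('o1, 'm1) category \<Rightarrow> ('o2, 'm2) category \<Rightarrow> ('o1 \<times> 'o2, 'm1 \<times> 'm2) category" where
  "prod_category C D = \<lparr>Obj = Obj C \<times> Obj D,
     Hom = \<lambda>(A, A') (B, B'). Hom C A B \<times> Hom D A' B',
     Ident = \<lambda>(A, A'). (Ident C A, Ident D A'),
     Comp = \<lambda>(A, A') (B, B') (E, E') (g, g') (f, f'). (Comp C A B E g f, Comp D A' B' E' g' f')\<rparr>"

definition id_functor :: "('o, 'm, 'o, 'm) functr" where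
  "id_functor = \<lparr>fob = \<lambda>A. A, far = \<lambda>A B f. f\<rparr>"

definition comp_functor ::
    "('o2, 'm2, 'o3, 'm3) functr \<Rightarrow> ('o1, 'm1, 'o2, 'm2) functr \<Rightarrow> ('o1, 'm1, 'o3, 'm3) functr"
  where
  "comp_functor G F = \<lparr>fob = \<lambda>A. fob G (fob F A),
     far = \<lambda>A B f. far G (fob F A) (fob F B) (far F A B f)\<rparr>"

definition prod_functor ::
    "('o1, 'm1, 'o2, 'm2) functr \<Rightarrow> ('o3, 'm3, 'o4, 'm4) functr
      \<Rightarrow> ('o1 \<times> 'o3, 'm1 \<times> 'm3, 'o2 \<times> 'o4, 'm2 \<times> 'm4) functr" where
  "prod_functor F G = \<lparr>fob = \<lambda>(A, A'). (fob F A, fob G A'),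
     far = \<lambda>(A, A') (B, B') (f, f'). (far F A B f, far G A' B' f')\<rparr>"

text \<open>Natural transformations are normalised to be \<open>undefined\<close> outside the objects of \<open>C\<close>.\<close>

definition functor_category ::
    "('o1, 'm1) category \<Rightarrow> ('o2, 'm2) category
      \<Rightarrow> (('o1, 'm1, 'o2, 'm2) functr, 'o1 \<Rightarrow> 'm2) category" where
  "functor_category C D = \<lparr>
     Obj = {F. is_functor C D F},
     Hom = \<lambda>F G. {\<alpha> \<in> (\<Pi>\<^sub>E A \<in> Obj C. Hom D (fob F A) (fob G A)).
       \<forall>A \<in> Obj C. \<forall>B \<in> Obj C. \<forall>f \<in> Hom C A B.
         Comp D (fob F A) (fob F B) (fob G B) (\<alpha> B) (far F A B f)
         = Comp D (fob F A) (fob G A) (fob G B) (far G A B f) (\<alpha> A)},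
     Ident = \<lambda>F. \<lambda>A \<in> Obj C. Ident D (fob F A),
     Comp = \<lambda>F G H \<beta> \<alpha>. \<lambda>A \<in> Obj C. Comp D (fob F A) (fob G A) (fob H A) (\<beta> A) (\<alpha> A)\<rparr>"


section \<open>Simplicial objects\<close>

text \<open>The object \<open>n\<close> of the simplex category is the ordinal \<open>[n] = {0, \<dots>, n}\<close>.\<close>

definition Delta :: "(nat, nat \<Rightarrow> nat) category" where
  "Delta = \<lparr>Obj = UNIV,
     Hom = \<lambda>m n. {\<theta> \<in> {..m} \<rightarrow>\<^sub>E {..n}. mono_on {..m} \<theta>},
     Ident = \<lambda>n. \<lambda>i \<in> {..n}. i,
     Comp = \<lambda>l m n g f. compose {..l} g f\<rparr>"

type_synonym ('o, 'm) simplicial = "(nat, nat \<Rightarrow> nat, 'o, 'm) functr"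

definition simplicial_category ::
    "('o, 'm) category \<Rightarrow> (('o, 'm) simplicial, nat \<Rightarrow> 'm) category" where
  "simplicial_category C = functor_category (opposite Delta) C"

definition degreewise ::
    "('o1, 'm1, 'o2, 'm2) functr
      \<Rightarrow> (('o1, 'm1) simplicial, nat \<Rightarrow> 'm1, ('o2, 'm2) simplicial, nat \<Rightarrow> 'm2) functr" where
  "degreewise G = \<lparr>fob = comp_functor G,
     far = \<lambda>X Y \<alpha>. \<lambda>n. far G (fob X n) (fob Y n) (\<alpha> n)\<rparr>"


section \<open>Sets, monoids and simplicial sets\<close>

text \<open>Functions out of a set \<open>A\<close> are normalised to be \<open>undefined\<close> outside \<open>A\<close>.\<close>

definition Set_cat :: "('a set, 'a \<Rightarrow> 'a) category" where
  "Set_cat = \<lparr>Obj = UNIV, Hom = \<lambda>A B. A \<rightarrow>\<^sub>E B, Ident = \<lambda>A. \<lambda>x \<in> A. x,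
     Comp = \<lambda>A B D g f. compose A g f\<rparr>"

text \<open>The library's \<open>hom\<close> does not ask for preservation of the unit.\<close>

definition monoid_hom :: "('a, 'c) monoid_scheme \<Rightarrow> ('b, 'd) monoid_scheme \<Rightarrow> ('a \<Rightarrow> 'b) set" where
  "monoid_hom M N = {f \<in> hom M N. f \<one>\<^bsub>M\<^esub> = \<one>\<^bsub>N\<^esub>}"

definition Mon_cat :: "('a monoid, 'a \<Rightarrow> 'a) category" where
  "Mon_cat = \<lparr>Obj = {M. monoid M},
     Hom = \<lambda>M N. {f \<in> carrier M \<rightarrow>\<^sub>E carrier N. f \<in> monoid_hom M N},
     Ident = \<lambda>M. \<lambda>x \<in> carrier M. x,
     Comp = \<lambda>L M N g f. compose (carrier L) g f\<rparr>"

definition forget :: "(('a, 'c) monoid_scheme, 'a \<Rightarrow> 'a, 'a set, 'a \<Rightarrow> 'a) functr" where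
  "forget = \<lparr>fob = carrier, far = \<lambda>M N f. f\<rparr>"

type_synonym 'a sset = "('a set, 'a \<Rightarrow> 'a) simplicial"

definition sSet_cat :: "('a sset, nat \<Rightarrow> 'a \<Rightarrow> 'a) category" where
  "sSet_cat = simplicial_category Set_cat"

text \<open>
  Simplicial maps between simplicial sets whose simplices may live in different types;
  when the types coincide these are the arrows of \<open>sSet_cat\<close> (see \<open>smap_eq_Hom\<close>).
\<close>

definition smap :: "'a sset \<Rightarrow> 'b sset \<Rightarrow> (nat \<Rightarrow> 'a \<Rightarrow> 'b) set" where
  "smap X Y = {\<phi>. (\<forall>n. \<phi> n \<in> fob X n \<rightarrow>\<^sub>E fob Y n) \<and>
     (\<forall>m n. \<forall>\<theta> \<in> Hom Delta m n.
       compose (fob X n) (\<phi> m) (far X n m \<theta>) = compose (fob X n) (far Y n m \<theta>) (\<phi> n))}"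

definition smap_comp ::
    "'a sset \<Rightarrow> (nat \<Rightarrow> 'b \<Rightarrow> 'c) \<Rightarrow> (nat \<Rightarrow> 'a \<Rightarrow> 'b) \<Rightarrow> nat \<Rightarrow> 'a \<Rightarrow> 'c" where
  "smap_comp X \<psi> \<phi> = (\<lambda>n. compose (fob X n) (\<psi> n) (\<phi> n))"

lemma smap_eq_Hom: "smap X Y = Hom sSet_cat X Y"
  unfolding smap_def sSet_cat_def simplicial_category_def functor_category_def opposite_def
    Delta_def Set_cat_def
  by (auto simp: PiE_def Pi_def)

lemma smap_comp_eq_Comp: "smap_comp X \<psi> \<phi> = Comp sSet_cat X Y Z \<psi> \<phi>"
  unfolding smap_comp_def sSet_cat_def simplicial_category_def functor_category_def opposite_def
    Delta_def Set_cat_def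
  by auto

text \<open>\<open>sSet(-,-)\<close>, contravariant in the first and covariant in the second argument.\<close>

definition sSet_hom ::
    "('x sset \<times> 'y sset, (nat \<Rightarrow> 'x \<Rightarrow> 'x) \<times> (nat \<Rightarrow> 'y \<Rightarrow> 'y),
      (nat \<Rightarrow> 'x \<Rightarrow> 'y) set, (nat \<Rightarrow> 'x \<Rightarrow> 'y) \<Rightarrow> (nat \<Rightarrow> 'x \<Rightarrow> 'y)) functr" where
  "sSet_hom = \<lparr>fob = \<lambda>(X, Y). smap X Y,
     far = \<lambda>(X, Y) (X', Y') (f, g). \<lambda>\<phi> \<in> smap X Y. smap_comp X' g (smap_comp X' \<phi> f)\<rparr>"


section \<open>The distribution monad\<close>

text \<open>
  The coefficients \<open>'r\<close> range over the sort \<open>{comm_semiring_0, comm_monoid_mult}\<close>, that is,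
  commutative semirings with unit. Unlike \<open>comm_semiring_1\<close>, this does not exclude \<open>0 = 1\<close>.
  A function on \<open>S\<close> with finite support is extended by \<open>0\<close> to the whole type.
\<close>

definition supp :: "('a \<Rightarrow> 'r::zero) \<Rightarrow> 'a set" where
  "supp p = {s. p s \<noteq> 0}"

definition Dset :: "'a set \<Rightarrow> ('a \<Rightarrow> 'r::{comm_semiring_0, comm_monoid_mult}) set" where
  "Dset S = {p. supp p \<subseteq> S \<and> finite (supp p) \<and> (\<Sum>s \<in> supp p. p s) = 1}"

definition delta :: "'a \<Rightarrow> 'a \<Rightarrow> 'r::{comm_semiring_0, comm_monoid_mult}" where
  "delta s = (\<lambda>t. if t = s then 1 else 0)"

definition Dmap ::
    "('a \<Rightarrow> 'b) \<Rightarrow> ('a \<Rightarrow> 'r::{comm_semiring_0, comm_monoid_mult}) \<Rightarrow> 'b \<Rightarrow> 'r" where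
  "Dmap f p = (\<lambda>t. \<Sum>s | s \<in> supp p \<and> f s = t. p s)"

definition mu ::
    "(('a \<Rightarrow> 'r) \<Rightarrow> 'r) \<Rightarrow> 'a \<Rightarrow> 'r::{comm_semiring_0, comm_monoid_mult}" where
  "mu P = (\<lambda>s. \<Sum>p \<in> supp P. P p * p s)"

definition Dconv ::
    "('a, 'c) monoid_scheme \<Rightarrow> ('a \<Rightarrow> 'r) \<Rightarrow> ('a \<Rightarrow> 'r)
      \<Rightarrow> 'a \<Rightarrow> 'r::{comm_semiring_0, comm_monoid_mult}" where
  "Dconv M p q = (\<lambda>m. \<Sum>(a, b) | a \<in> supp p \<and> b \<in> supp q \<and> a \<otimes>\<^bsub>M\<^esub> b = m. p a * q b)"

definition Dmonoid ::
    "('a, 'c) monoid_scheme \<Rightarrow> ('a \<Rightarrow> 'r::{comm_semiring_0, comm_monoid_mult}) monoid" where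
  "Dmonoid M = \<lparr>carrier = Dset (carrier M), mult = Dconv M, one = delta \<one>\<^bsub>M\<^esub>\<rparr>"

definition D_functor ::
    "('a set, 'a \<Rightarrow> 'a, ('a \<Rightarrow> 'r::{comm_semiring_0, comm_monoid_mult}) set,
      ('a \<Rightarrow> 'r) \<Rightarrow> ('a \<Rightarrow> 'r)) functr" where
  "D_functor = \<lparr>fob = Dset, far = \<lambda>S T f. \<lambda>p \<in> Dset S. Dmap f p\<rparr>"


section \<open>Convex monoids\<close>

record ('a, 'r) convex_monoid = "'a monoid" +
  conv :: "('a \<Rightarrow> 'r) \<Rightarrow> 'a"

locale convex_monoid = monoid M
  for M :: "('a, 'r::{comm_semiring_0, comm_monoid_mult}) convex_monoid" (structure) +
  assumes conv_hom: "conv M \<in> monoid_hom (Dmonoid M) M"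
    and conv_delta: "s \<in> carrier M \<Longrightarrow> conv M (delta s) = s"
    and conv_mu: "P \<in> Dset (Dset (carrier M) :: ('a \<Rightarrow> 'r) set)
                    \<Longrightarrow> conv M (Dmap (conv M) (P :: ('a \<Rightarrow> 'r) \<Rightarrow> 'r)) = conv M (mu P)"

definition ConvMon_cat ::
    "(('a, 'r::{comm_semiring_0, comm_monoid_mult}) convex_monoid, 'a \<Rightarrow> 'a) category" where
  "ConvMon_cat = \<lparr>Obj = {M. convex_monoid M},
     Hom = \<lambda>M N. {f \<in> carrier M \<rightarrow>\<^sub>E carrier N. f \<in> monoid_hom M N \<and>
       (\<forall>p \<in> Dset (carrier M). conv N (Dmap f p) = f (conv M p))},
     Ident = \<lambda>M. \<lambda>x \<in> carrier M. x,
     Comp = \<lambda>L M N g f. compose (carrier L) g f\<rparr>"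

definition free_convex ::
    "('a monoid, 'a \<Rightarrow> 'a,
      ('a \<Rightarrow> 'r::{comm_semiring_0, comm_monoid_mult}, 'r) convex_monoid,
      ('a \<Rightarrow> 'r) \<Rightarrow> ('a \<Rightarrow> 'r)) functr" where
  "free_convex = \<lparr>
     fob = \<lambda>M. \<lparr>carrier = Dset (carrier M), mult = Dconv M, one = delta \<one>\<^bsub>M\<^esub>, conv = mu\<rparr>,
     far = \<lambda>M N f. \<lambda>p \<in> Dset (carrier M). Dmap f p\<rparr>"

type_synonym ('a, 'r) sconvex_monoid = "(('a, 'r) convex_monoid, 'a \<Rightarrow> 'a) simplicial"

definition sConvMon_cat ::
    "(('a, 'r::{comm_semiring_0, comm_monoid_mult}) sconvex_monoid, nat \<Rightarrow> 'a \<Rightarrow> 'a) category" where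
  "sConvMon_cat = simplicial_category ConvMon_cat"


section \<open>Mapping sets into simplicial convex monoids\<close>

abbreviation D_sset ::
    "'a sset \<Rightarrow> ('a \<Rightarrow> 'r::{comm_semiring_0, comm_monoid_mult}) sset" where
  "D_sset Y \<equiv> fob (degreewise D_functor) Y"

abbreviation underlying_sset ::
    "(('a, 'c) monoid_scheme, 'a \<Rightarrow> 'a) simplicial \<Rightarrow> 'a sset" where
  "underlying_sset Y \<equiv> fob (degreewise forget) Y"

definition Theta ::
    "'x sset \<Rightarrow> ((nat \<Rightarrow> 'x \<Rightarrow> 'y) \<Rightarrow> 'r)
      \<Rightarrow> nat \<Rightarrow> 'x \<Rightarrow> 'y \<Rightarrow> 'r::{comm_semiring_0, comm_monoid_mult}" where
  "Theta X d = (\<lambda>n. \<lambda>x \<in> fob X n. \<lambda>y. \<Sum>\<phi> \<in> supp d. d \<phi> * delta (\<phi> n x) y)"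

text \<open>The structure maps of \<open>Y\<close>, as a simplicial map from \<open>D_sset (underlying_sset Y)\<close> to
  \<open>underlying_sset Y\<close>.\<close>

definition sconv ::
    "('y, 'r::{comm_semiring_0, comm_monoid_mult}) sconvex_monoid \<Rightarrow> nat \<Rightarrow> ('y \<Rightarrow> 'r) \<Rightarrow> 'y" where
  "sconv Y = (\<lambda>n. \<lambda>p \<in> Dset (carrier (fob Y n)). conv (fob Y n) p)"

definition mapping_convex_monoid ::
    "'x sset \<Rightarrow> ('y, 'r::{comm_semiring_0, comm_monoid_mult}) sconvex_monoid
      \<Rightarrow> (nat \<Rightarrow> 'x \<Rightarrow> 'y, 'r) convex_monoid" where
  "mapping_convex_monoid X Y = \<lparr>
     carrier = smap X (underlying_sset Y),
     mult = \<lambda>\<phi> \<psi>. \<lambda>n. \<lambda>x \<in> fob X n. \<phi> n x \<otimes>\<^bsub>fob Y n\<^esub> \<psi> n x,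
     one = \<lambda>n. \<lambda>x \<in> fob X n. \<one>\<^bsub>fob Y n\<^esub>,
     conv = \<lambda>d. smap_comp X (sconv Y) (Theta X d)\<rparr>"

definition sSet_hom_convex ::
    "('x sset \<times> ('y, 'r::{comm_semiring_0, comm_monoid_mult}) sconvex_monoid,
      (nat \<Rightarrow> 'x \<Rightarrow> 'x) \<times> (nat \<Rightarrow> 'y \<Rightarrow> 'y),
      (nat \<Rightarrow> 'x \<Rightarrow> 'y, 'r) convex_monoid, (nat \<Rightarrow> 'x \<Rightarrow> 'y) \<Rightarrow> (nat \<Rightarrow> 'x \<Rightarrow> 'y)) functr" where
  "sSet_hom_convex = \<lparr>
     fob = \<lambda>(X, Y). mapping_convex_monoid X Y,
     far = \<lambda>(X, Y) (X', Y') h. far sSet_hom (X, underlying_sset Y) (X', underlying_sset Y') h\<rparr>"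

end

(*
  With the Kleisli extension Dbind p k = sum_s p(s) k(s), the maps Dmap, mu and the convolution are
  all iterated binds of delta distributions, so every identity about them follows from the monad
  laws and from the commutativity of the monad (Fubini for finite sums).

  Theta(d) at a simplex x is the push-forward of d under evaluation at x. Hence the structure map of
  sSet(X, Y), like the product, is computed simplex by simplex in the convex monoids Y_n, and since
  simplicial maps are determined by their values, the algebra laws are inherited from the Y_n.
*)
theory Submission
  imports Defs
begin

section \<open>Finitely supported distributions\<close>

text \<open>Two conventions shape the details. Coefficients may cancel, and when
  \<open>0 = 1\<close> even a delta has empty support, so the support of a bind is only contained in
  the expected union; sums are therefore first moved to a convenient finite superset. Arrows are
  \<open>undefined\<close> off their domain, so composites and restrictions reduce only at arguments
  known to lie in the domain; this explains the many membership facts, and it is also what makes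
  simplicial maps equal as soon as they agree on simplices. The commutativity of the coefficients is
  indispensable for one point: convolution of averages must be the average of convolutions, that is,
  \<open>mu\<close> must be multiplicative.\<close>

lemma finite_supp_delta [simp]:
  "finite (supp (delta s :: 'a \<Rightarrow> 'r::{comm_semiring_0, comm_monoid_mult}))"
  by (rule finite_subset[of _ "{s}"]) (auto simp: supp_def delta_def)

lemma DsetD:
  assumes "p \<in> Dset S"
  shows "finite (supp p)" and "\<And>s. s \<in> supp p \<Longrightarrow> s \<in> S" and "sum p (supp p) = 1"
  using assms by (auto simp: Dset_def)

text \<open>The integral of \<open>h\<close> against \<open>p\<close>. It is kept separate from
  \<open>Dbind\<close> because its values are scalars: total mass is the case of the constant 1, and
  a bind is an integral at each point.\<close>

definition Dint :: "('a \<Rightarrow> 'r::{comm_semiring_0, comm_monoid_mult}) \<Rightarrow> ('a \<Rightarrow> 'r) \<Rightarrow> 'r" where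
  "Dint p h = (\<Sum>s \<in> supp p. p s * h s)"

definition Dbind ::
    "('a \<Rightarrow> 'r::{comm_semiring_0, comm_monoid_mult}) \<Rightarrow> ('a \<Rightarrow> 'b \<Rightarrow> 'r) \<Rightarrow> 'b \<Rightarrow> 'r" where
  "Dbind p k = (\<lambda>t. Dint p (\<lambda>s. k s t))"

lemma Dint_superset:
  assumes "finite A" and "supp p \<subseteq> A"
  shows "Dint p h = (\<Sum>s \<in> A. p s * h s)"
  unfolding Dint_def using assms by (intro sum.mono_neutral_left) (auto simp: supp_def)

lemma Dint_cong: "(\<And>s. s \<in> supp p \<Longrightarrow> h s = h' s) \<Longrightarrow> Dint p h = Dint p h'"
  unfolding Dint_def by (rule sum.cong) auto

lemma Dbind_cong: "(\<And>s. s \<in> supp p \<Longrightarrow> k s = k' s) \<Longrightarrow> Dbind p k = Dbind p k'"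
  unfolding Dbind_def by (intro ext Dint_cong) simp

text \<open>Only an inclusion: the contributions of different \<open>s\<close> to the value at
  \<open>t\<close> may cancel.\<close>

lemma supp_Dbind: "supp (Dbind p k) \<subseteq> (\<Union>s \<in> supp p. supp (k s))"
proof
  fix t assume "t \<in> supp (Dbind p k)"
  then have "(\<Sum>s \<in> supp p. p s * k s t) \<noteq> 0"
    by (simp add: supp_def Dbind_def Dint_def)
  then obtain s where "s \<in> supp p" "p s * k s t \<noteq> 0"
    by (rule sum.not_neutral_contains_not_neutral)
  then show "t \<in> (\<Union>s \<in> supp p. supp (k s))"
    by (auto simp: supp_def)
qed

lemma finite_supp_Dbind [simp]:
  "finite (supp p) \<Longrightarrow> (\<And>s. s \<in> supp p \<Longrightarrow> finite (supp (k s))) \<Longrightarrow> finite (supp (Dbind p k))"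
  by (rule finite_subset[OF supp_Dbind]) simp

lemma Dint_Dbind:
  assumes "finite (supp p)" and "\<And>s. s \<in> supp p \<Longrightarrow> finite (supp (k s))"
  shows "Dint (Dbind p k) h = Dint p (\<lambda>s. Dint (k s) h)"
proof -
  \<comment> \<open>One finite set contains the support of the bind and every
    \<open>supp (k s)\<close>. With this common index set, independent of \<open>s\<close>, the two
    sums can be exchanged.\<close>
  define B where "B = (\<Union>s \<in> supp p. supp (k s))"
  have B: "finite B"
    using assms by (simp add: B_def)
  have "Dint (Dbind p k) h = (\<Sum>t \<in> B. (\<Sum>s \<in> supp p. p s * k s t) * h t)"
    using Dint_superset[OF B, of "Dbind p k"] supp_Dbind[of p k]
    by (simp add: B_def Dbind_def Dint_def)
  also have "\<dots> = (\<Sum>t \<in> B. \<Sum>s \<in> supp p. p s * (k s t * h t))"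
    by (simp add: sum_distrib_right mult.assoc)
  also have "\<dots> = (\<Sum>s \<in> supp p. \<Sum>t \<in> B. p s * (k s t * h t))"
    by (rule sum.swap)
  also have "\<dots> = (\<Sum>s \<in> supp p. p s * Dint (k s) h)"
  proof (rule sum.cong[OF refl])
    fix s assume "s \<in> supp p"
    then have "Dint (k s) h = (\<Sum>t \<in> B. k s t * h t)"
      by (intro Dint_superset B) (auto simp: B_def)
    then show "(\<Sum>t \<in> B. p s * (k s t * h t)) = p s * Dint (k s) h"
      by (simp add: sum_distrib_left)
  qed
  finally show ?thesis
    by (simp add: Dint_def)
qed

lemma Dbind_assoc:
  "finite (supp p) \<Longrightarrow> (\<And>s. s \<in> supp p \<Longrightarrow> finite (supp (k s))) \<Longrightarrow>
    Dbind (Dbind p k) l = Dbind p (\<lambda>s. Dbind (k s) l)"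
  \<comment> \<open>The instances open only the outer binds; \<open>Dbind p k\<close> stays folded
    so that \<open>Dint_Dbind\<close> can match it.\<close>
  unfolding Dbind_def[of _ l] Dbind_def[of p "\<lambda>s t. Dint (k s) (\<lambda>s. l s t)"]
  by (simp add: Dint_Dbind)

lemma Dbind_delta_left [simp]: "Dbind (delta s) k = k s"
proof
  fix t
  have "Dint (delta s) (\<lambda>s. k s t) = (\<Sum>u \<in> {s}. delta s u * k u t)"
    by (rule Dint_superset) (auto simp: supp_def delta_def)
  then show "Dbind (delta s) k t = k s t"
    by (simp add: Dbind_def delta_def)
qed

lemma Dbind_delta_right [simp]: "finite (supp p) \<Longrightarrow> Dbind p delta = p"
proof
  fix t assume fin: "finite (supp p)"
  \<comment> \<open>The point \<open>t\<close> may lie outside \<open>supp p\<close>; inserting it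
    lets the sum collapse to \<open>{t}\<close> without a case split.\<close>
  have "Dbind p delta t = (\<Sum>s \<in> insert t (supp p). p s * delta s t)"
    unfolding Dbind_def using fin by (intro Dint_superset) auto
  also have "\<dots> = (\<Sum>s \<in> {t}. p s * delta s t)"
    using fin by (intro sum.mono_neutral_right) (auto simp: delta_def)
  finally show "Dbind p delta t = p t"
    by (simp add: delta_def)
qed

text \<open>Two independent draws can be made in either order. Besides exchanging the sums, this
  moves \<open>q b\<close> past \<open>p a\<close>, which uses the commutativity of the
  coefficients.\<close>

lemma Dbind_commute: "Dbind p (\<lambda>a. Dbind q (\<lambda>b. k a b)) = Dbind q (\<lambda>b. Dbind p (\<lambda>a. k a b))"
proof
  fix t
  have "(\<Sum>a \<in> supp p. p a * (\<Sum>b \<in> supp q. q b * k a b t))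
      = (\<Sum>a \<in> supp p. \<Sum>b \<in> supp q. q b * (p a * k a b t))"
    by (simp add: sum_distrib_left mult.left_commute)
  also have "\<dots> = (\<Sum>b \<in> supp q. \<Sum>a \<in> supp p. q b * (p a * k a b t))"
    by (rule sum.swap)
  also have "\<dots> = (\<Sum>b \<in> supp q. q b * (\<Sum>a \<in> supp p. p a * k a b t))"
    by (simp add: sum_distrib_left)
  finally show "Dbind p (\<lambda>a. Dbind q (\<lambda>b. k a b)) t = Dbind q (\<lambda>b. Dbind p (\<lambda>a. k a b)) t"
    by (simp add: Dbind_def Dint_def)
qed

text \<open>With total mass written as an integral, \<open>Dint_Dbind\<close> computes the mass of a
  bind as the average of the masses of the \<open>k s\<close>.\<close>

lemma Dset_iff_Dint: "p \<in> Dset S \<longleftrightarrow> supp p \<subseteq> S \<and> finite (supp p) \<and> Dint p (\<lambda>_. 1) = 1"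
  by (simp add: Dset_def Dint_def)

lemma Dbind_in_Dset:
  assumes p: "p \<in> Dset S" and k: "\<And>s. s \<in> S \<Longrightarrow> k s \<in> Dset T"
  shows "Dbind p k \<in> Dset T"
proof -
  have k': "k s \<in> Dset T" if "s \<in> supp p" for s
    using that p k by (auto simp: Dset_def)
  have "Dint (Dbind p k) (\<lambda>_. 1) = Dint p (\<lambda>s. Dint (k s) (\<lambda>_. 1))"
    using p k' by (intro Dint_Dbind) (auto simp: Dset_def)
  also have "\<dots> = Dint p (\<lambda>_. 1)"
    using k' by (intro Dint_cong) (auto simp: Dset_iff_Dint)
  finally show ?thesis
    using p k' supp_Dbind[of p k] by (fastforce simp: Dset_iff_Dint)
qed

lemma delta_in_Dset:
  "s \<in> S \<Longrightarrow> (delta s :: 'a \<Rightarrow> 'r::{comm_semiring_0, comm_monoid_mult}) \<in> Dset S"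
proof -
  assume "s \<in> S"
  moreover have "Dint (delta s :: 'a \<Rightarrow> 'r) (\<lambda>_. 1) = (\<Sum>u \<in> {s}. delta s u * 1)"
    by (rule Dint_superset) (auto simp: supp_def delta_def)
  ultimately show ?thesis
    by (auto simp: Dset_iff_Dint) (auto simp: supp_def delta_def split: if_splits)
qed

section \<open>Push-forward, multiplication and convolution as binds\<close>

text \<open>The delta acts as the indicator of the fibre of \<open>f\<close> over \<open>t\<close>.
  Finiteness matters: a sum over an infinite support is 0 by convention, while a single fibre may
  still be finite.\<close>

lemma Dmap_eq_Dbind: "finite (supp p) \<Longrightarrow> Dmap f p = Dbind p (\<lambda>s. delta (f s))"
  unfolding Dmap_def Dbind_def Dint_def
  by (rule ext) (auto simp: delta_def sum.If_cases split: if_splits intro!: sum.mono_neutral_cong_left)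

lemma mu_eq_Dbind: "mu P = Dbind P (\<lambda>p. p)"
  by (simp add: mu_def Dbind_def Dint_def)

lemma Dconv_eq_Dbind:
  assumes "finite (supp p)" and "finite (supp q)"
  shows "Dconv M p q = Dbind p (\<lambda>a. Dbind q (\<lambda>b. delta (a \<otimes>\<^bsub>M\<^esub> b)))"
proof
  fix m
  have "Dconv M p q m = (\<Sum>(a, b) \<in> supp p \<times> supp q. p a * (q b * delta (a \<otimes>\<^bsub>M\<^esub> b) m))"
    unfolding Dconv_def using assms
    by (intro sum.mono_neutral_cong_left) (auto simp: delta_def split: if_splits)
  also have "\<dots> = (\<Sum>a \<in> supp p. p a * (\<Sum>b \<in> supp q. q b * delta (a \<otimes>\<^bsub>M\<^esub> b) m))"
    by (simp add: sum.cartesian_product[symmetric] sum_distrib_left)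
  finally show "Dconv M p q m = Dbind p (\<lambda>a. Dbind q (\<lambda>b. delta (a \<otimes>\<^bsub>M\<^esub> b))) m"
    by (simp add: Dbind_def Dint_def)
qed

lemma Dmap_in_Dset: "p \<in> Dset S \<Longrightarrow> (\<And>s. s \<in> S \<Longrightarrow> f s \<in> T) \<Longrightarrow> Dmap f p \<in> Dset T"
  by (simp add: Dmap_eq_Dbind DsetD(1)) (blast intro: Dbind_in_Dset delta_in_Dset)

text \<open>A push-forward sees \<open>f\<close> only on \<open>S\<close>. Later this exchanges
  \<open>restrict\<close> and \<open>compose\<close>, which are \<open>undefined\<close> elsewhere,
  for plain functions.\<close>

lemma Dmap_cong: "p \<in> Dset S \<Longrightarrow> (\<And>s. s \<in> S \<Longrightarrow> f s = g s) \<Longrightarrow> Dmap f p = Dmap g p"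
  by (simp add: Dmap_eq_Dbind DsetD(1)) (rule Dbind_cong, simp add: DsetD(2))

lemma Dmap_Dmap: "p \<in> Dset S \<Longrightarrow> Dmap g (Dmap f p) = Dmap (\<lambda>s. g (f s)) p"
  by (simp add: Dmap_eq_Dbind Dbind_assoc DsetD(1))

lemma Dmap_ident: "p \<in> Dset S \<Longrightarrow> (\<And>s. s \<in> S \<Longrightarrow> f s = s) \<Longrightarrow> Dmap f p = p"
  using Dmap_cong[of p S f "\<lambda>s. s"] by (simp add: Dmap_eq_Dbind DsetD(1))

lemma Dmap_delta [simp]: "Dmap f (delta s) = delta (f s)"
  by (simp add: Dmap_eq_Dbind)

lemma mu_delta [simp]: "mu (delta p) = p"
  by (simp add: mu_eq_Dbind)

lemma mu_in_Dset: "P \<in> Dset (Dset S) \<Longrightarrow> mu P \<in> Dset S"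
  unfolding mu_eq_Dbind by (rule Dbind_in_Dset)

text \<open>Naturality of the multiplication: both sides are the average
  \<open>Dbind P (Dmap f)\<close> of the push-forwards.\<close>

lemma Dmap_mu:
  assumes "P \<in> Dset (Dset S)"
  shows "Dmap f (mu P) = mu (Dmap (Dmap f) P)"
proof -
  have fin: "finite (supp P)" "\<And>p. p \<in> supp P \<Longrightarrow> finite (supp p)" "finite (supp (mu P))"
    using assms DsetD(1)[OF mu_in_Dset[OF assms]] by (auto dest: DsetD)
  have "mu (Dmap (Dmap f) P) = Dbind P (Dmap f)"
    using fin by (simp add: mu_eq_Dbind Dmap_eq_Dbind Dbind_assoc)
  also have "\<dots> = Dbind P (\<lambda>p. Dbind p (\<lambda>s. delta (f s)))"
    using fin by (intro Dbind_cong) (simp add: Dmap_eq_Dbind)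
  also have "\<dots> = Dmap f (mu P)"
    \<comment> \<open>\<open>Dmap\<close> is expanded while \<open>mu P\<close> is still folded, so
      that its finite support is available from \<open>fin\<close>; only then is \<open>mu\<close>
      opened.\<close>
    using fin by (simp add: Dmap_eq_Dbind) (simp add: mu_eq_Dbind Dbind_assoc)
  finally show ?thesis ..
qed

text \<open>The associativity law of the monad, which becomes the second algebra law of the free
  convex monoid.\<close>

lemma mu_Dmap_mu:
  assumes "P \<in> Dset (Dset (Dset S))"
  shows "mu (Dmap mu P) = mu (mu P)"
proof -
  have fin: "finite (supp P)" "\<And>p. p \<in> supp P \<Longrightarrow> finite (supp p)"
    using assms by (auto dest: DsetD)
  have "mu (Dmap mu P) = Dbind P mu"
    using fin unfolding mu_eq_Dbind[of "Dmap mu P"] by (simp add: Dmap_eq_Dbind Dbind_assoc)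
  also have "\<dots> = Dbind P (\<lambda>p. Dbind p (\<lambda>q. q))"
    by (intro Dbind_cong mu_eq_Dbind)
  also have "\<dots> = mu (mu P)"
    using fin by (simp add: mu_eq_Dbind Dbind_assoc)
  finally show ?thesis .
qed

section \<open>Convolution of distributions on a monoid\<close>

lemma (in monoid) Dconv_in_Dset:
  assumes "p \<in> Dset (carrier G)" and "q \<in> Dset (carrier G)"
  shows "Dconv G p q \<in> Dset (carrier G)"
  unfolding Dconv_eq_Dbind[OF assms[THEN DsetD(1)]] using assms
  by (auto intro!: Dbind_in_Dset delta_in_Dset)

lemma (in monoid) Dconv_delta_one_left:
  assumes "p \<in> Dset (carrier G)" shows "Dconv G (delta \<one>) p = p"
proof -
  have "Dconv G (delta \<one>) p = Dbind p (\<lambda>a. delta (\<one> \<otimes> a))"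
    using assms by (simp add: Dconv_eq_Dbind DsetD(1))
  also have "\<dots> = Dbind p delta"
    using assms by (intro Dbind_cong) (auto dest: DsetD)
  finally show ?thesis
    using assms by (simp add: DsetD(1))
qed

lemma (in monoid) Dconv_delta_one_right:
  assumes "p \<in> Dset (carrier G)" shows "Dconv G p (delta \<one>) = p"
proof -
  have "Dconv G p (delta \<one>) = Dbind p (\<lambda>a. delta (a \<otimes> \<one>))"
    using assms by (simp add: Dconv_eq_Dbind DsetD(1))
  also have "\<dots> = Dbind p delta"
    using assms by (intro Dbind_cong) (auto dest: DsetD)
  finally show ?thesis
    using assms by (simp add: DsetD(1))
qed

lemma (in monoid) Dconv_assoc:
  assumes p: "p \<in> Dset (carrier G)" and q: "q \<in> Dset (carrier G)" and r: "r \<in> Dset (carrier G)"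
  shows "Dconv G (Dconv G p q) r = Dconv G p (Dconv G q r)"
proof -
  note fin = p[THEN DsetD(1)] q[THEN DsetD(1)] r[THEN DsetD(1)]
  have "Dconv G (Dconv G p q) r
      = Dbind p (\<lambda>a. Dbind q (\<lambda>b. Dbind r (\<lambda>c. delta (a \<otimes> b \<otimes> c))))"
    using fin by (simp add: Dconv_eq_Dbind Dbind_assoc)
  also have "\<dots> = Dbind p (\<lambda>a. Dbind q (\<lambda>b. Dbind r (\<lambda>c. delta (a \<otimes> (b \<otimes> c)))))"
    \<comment> \<open>Associativity is available only on the carrier; \<open>Dbind_cong\<close>
      restricts \<open>a\<close>, \<open>b\<close> and \<open>c\<close> to the supports, which lie
      in it.\<close>
    using p q r by (intro Dbind_cong) (auto simp: m_assoc dest!: DsetD(2))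
  also have "\<dots> = Dconv G p (Dconv G q r)"
    using fin by (simp add: Dconv_eq_Dbind Dbind_assoc)
  finally show ?thesis .
qed

lemma Dmap_Dconv:
  assumes p: "p \<in> Dset (carrier M)" and q: "q \<in> Dset (carrier M)" and f: "f \<in> hom M N"
  shows "Dmap f (Dconv M p q) = Dconv N (Dmap f p) (Dmap f q)"
proof -
  note fin = p[THEN DsetD(1)] q[THEN DsetD(1)]
  have "Dmap f (Dconv M p q) = Dbind p (\<lambda>a. Dbind q (\<lambda>b. delta (f (a \<otimes>\<^bsub>M\<^esub> b))))"
    using fin by (simp add: Dconv_eq_Dbind Dmap_eq_Dbind Dbind_assoc)
  also have "\<dots> = Dbind p (\<lambda>a. Dbind q (\<lambda>b. delta (f a \<otimes>\<^bsub>N\<^esub> f b)))"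
    using p q f by (intro Dbind_cong) (auto simp: hom_mult dest!: DsetD(2))
  also have "\<dots> = Dconv N (Dmap f p) (Dmap f q)"
    using fin by (simp add: Dconv_eq_Dbind Dmap_eq_Dbind Dbind_assoc)
  finally show ?thesis .
qed

text \<open>\<open>N\<close> is any record on distributions whose product is convolution over
  \<open>M\<close>, so that \<open>fob free_convex M\<close>, with its additional field
  \<open>conv\<close>, is covered.\<close>

lemma mu_Dconv:
  fixes M :: "('a, 'c) monoid_scheme" and N :: "('a \<Rightarrow> 'r::{comm_semiring_0, comm_monoid_mult}, 'd) monoid_scheme"
  assumes P: "P \<in> Dset (Dset S)" and Q: "Q \<in> Dset (Dset S)" and N: "mult N = Dconv M"
  shows "mu (Dconv N P Q) = Dconv M (mu P) (mu Q)"
proof -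
  have fin: "finite (supp P)" "finite (supp Q)" "\<And>p. p \<in> supp P \<Longrightarrow> finite (supp p)"
    "\<And>q. q \<in> supp Q \<Longrightarrow> finite (supp q)" "finite (supp (mu P))" "finite (supp (mu Q))"
    using P Q mu_in_Dset[OF P] mu_in_Dset[OF Q] by (auto dest: DsetD)
  have "mu (Dconv N P Q) = Dbind P (\<lambda>p. Dbind Q (\<lambda>q. Dconv M p q))"
    using fin by (simp add: mu_eq_Dbind Dconv_eq_Dbind N Dbind_assoc)
  also have "\<dots> = Dbind P (\<lambda>p. Dbind Q (\<lambda>q. Dbind p (\<lambda>a. Dbind q (\<lambda>b. delta (a \<otimes>\<^bsub>M\<^esub> b)))))"
    using fin by (intro Dbind_cong) (simp add: Dconv_eq_Dbind)
  \<comment> \<open>The draw of \<open>a\<close> depends on \<open>p\<close> but not on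
    \<open>q\<close>, so it may precede the draw of \<open>q\<close>. Afterwards the pairs
    \<open>P\<close>, \<open>p\<close> and \<open>Q\<close>, \<open>q\<close> each collapse to a
    draw from \<open>mu P\<close> and \<open>mu Q\<close>.\<close>
  also have "\<dots> = Dbind P (\<lambda>p. Dbind p (\<lambda>a. Dbind Q (\<lambda>q. Dbind q (\<lambda>b. delta (a \<otimes>\<^bsub>M\<^esub> b)))))"
    by (rule Dbind_cong) (rule Dbind_commute)
  also have "\<dots> = Dconv M (mu P) (mu Q)"
    unfolding Dconv_eq_Dbind[OF fin(5,6)] using fin by (simp add: mu_eq_Dbind Dbind_assoc)
  finally show ?thesis .
qed


section \<open>The categories involved\<close>

lemma category_opposite:
  assumes "category C" shows "category (opposite C)"
proof -
  interpret category C by fact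
  show ?thesis
    by unfold_locales
      (simp_all add: opposite_def Ident_in_Hom Comp_in_Hom Comp_Ident_left Comp_Ident_right
        Comp_assoc)
qed

lemma category_prod:
  assumes "category C" and "category D" shows "category (prod_category C D)"
proof -
  interpret C: category C by fact
  interpret D: category D by fact
  show ?thesis
    by unfold_locales
      (auto simp: prod_category_def C.Ident_in_Hom C.Comp_in_Hom C.Comp_Ident_left
        C.Comp_Ident_right C.Comp_assoc D.Ident_in_Hom D.Comp_in_Hom D.Comp_Ident_left
        D.Comp_Ident_right D.Comp_assoc)
qed

lemma category_functor_category:
  assumes "category C" and "category D" shows "category (functor_category C D)"
proof -
  interpret C: category C by fact
  interpret D: category D by fact
  show ?thesis
  proof
    fix F assume "F \<in> Obj (functor_category C D)"
    then interpret F: is_functor C D F by (simp add: functor_category_def)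
    show "Ident (functor_category C D) F \<in> Hom (functor_category C D) F F"
      by (auto simp: functor_category_def F.fob_in_Obj F.far_in_Hom D.Ident_in_Hom
          D.Comp_Ident_left D.Comp_Ident_right)
  next
    fix F G H \<alpha> \<beta>
    assume "F \<in> Obj (functor_category C D)" "G \<in> Obj (functor_category C D)"
      "H \<in> Obj (functor_category C D)"
      and \<alpha>: "\<alpha> \<in> Hom (functor_category C D) F G" and \<beta>: "\<beta> \<in> Hom (functor_category C D) G H"
    then interpret F: is_functor C D F + G: is_functor C D G + H: is_functor C D H
      by (simp_all add: functor_category_def)
    have \<alpha>': "\<And>A. A \<in> Obj C \<Longrightarrow> \<alpha> A \<in> Hom D (fob F A) (fob G A)"
      and \<beta>': "\<And>A. A \<in> Obj C \<Longrightarrow> \<beta> A \<in> Hom D (fob G A) (fob H A)"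
      using \<alpha> \<beta> by (auto simp: functor_category_def)
    note hom = F.fob_in_Obj G.fob_in_Obj H.fob_in_Obj F.far_in_Hom G.far_in_Hom H.far_in_Hom \<alpha>' \<beta>'
    have "Comp D (fob F A) (fob F B) (fob H B) (Comp D (fob F B) (fob G B) (fob H B) (\<beta> B) (\<alpha> B))
            (far F A B f)
        = Comp D (fob F A) (fob H A) (fob H B) (far H A B f)
            (Comp D (fob F A) (fob G A) (fob H A) (\<beta> A) (\<alpha> A))"
      if "A \<in> Obj C" "B \<in> Obj C" "f \<in> Hom C A B" for A B f
    proof -
      \<comment> \<open>Pasting of the naturality squares of \<open>\<alpha>\<close> and
        \<open>\<beta>\<close>, with associativity between the two uses.\<close>
      have "Comp D (fob F A) (fob F B) (fob H B)
            (Comp D (fob F B) (fob G B) (fob H B) (\<beta> B) (\<alpha> B)) (far F A B f)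
          = Comp D (fob F A) (fob G B) (fob H B) (\<beta> B)
              (Comp D (fob F A) (fob F B) (fob G B) (\<alpha> B) (far F A B f))"
        using that by (intro D.Comp_assoc[symmetric] hom)
      also have "\<dots> = Comp D (fob F A) (fob G B) (fob H B) (\<beta> B)
              (Comp D (fob F A) (fob G A) (fob G B) (far G A B f) (\<alpha> A))"
        using \<alpha> that by (simp add: functor_category_def)
      also have "\<dots> = Comp D (fob F A) (fob G A) (fob H B)
              (Comp D (fob G A) (fob G B) (fob H B) (\<beta> B) (far G A B f)) (\<alpha> A)"
        using that by (intro D.Comp_assoc hom)
      also have "\<dots> = Comp D (fob F A) (fob G A) (fob H B)
              (Comp D (fob G A) (fob H A) (fob H B) (far H A B f) (\<beta> A)) (\<alpha> A)"
        using \<beta> that by (simp add: functor_category_def)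
      also have "\<dots> = Comp D (fob F A) (fob H A) (fob H B) (far H A B f)
            (Comp D (fob F A) (fob G A) (fob H A) (\<beta> A) (\<alpha> A))"
        using that by (intro D.Comp_assoc[symmetric] hom)
      finally show ?thesis .
    qed
    then show "Comp (functor_category C D) F G H \<beta> \<alpha> \<in> Hom (functor_category C D) F H"
      by (auto simp: functor_category_def intro!: D.Comp_in_Hom hom)
  next
    fix F G \<alpha>
    assume "F \<in> Obj (functor_category C D)" "G \<in> Obj (functor_category C D)"
      and \<alpha>: "\<alpha> \<in> Hom (functor_category C D) F G"
    then interpret F: is_functor C D F + G: is_functor C D G
      by (simp_all add: functor_category_def)
    have \<alpha>': "\<alpha> \<in> (\<Pi>\<^sub>E A \<in> Obj C. Hom D (fob F A) (fob G A))"
      using \<alpha> by (simp add: functor_category_def)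
    note mem = F.fob_in_Obj G.fob_in_Obj PiE_mem[OF \<alpha>']
    show "Comp (functor_category C D) F F G \<alpha> (Ident (functor_category C D) F) = \<alpha>"
      and "Comp (functor_category C D) F G G (Ident (functor_category C D) G) \<alpha> = \<alpha>"
      \<comment> \<open>Composites are \<open>undefined\<close> off the objects of \<open>C\<close>,
        so the unit laws also need that \<open>\<alpha>\<close> is.\<close>
      using mem PiE_arb[OF \<alpha>']
      by (auto simp: functor_category_def fun_eq_iff restrict_def D.Comp_Ident_left
          D.Comp_Ident_right)
  next
    fix F G H K \<alpha> \<beta> \<gamma>
    assume "F \<in> Obj (functor_category C D)" "G \<in> Obj (functor_category C D)"
      "H \<in> Obj (functor_category C D)" "K \<in> Obj (functor_category C D)"
      and nat: "\<alpha> \<in> Hom (functor_category C D) F G" "\<beta> \<in> Hom (functor_category C D) G H"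
        "\<gamma> \<in> Hom (functor_category C D) H K"
    then interpret F: is_functor C D F + G: is_functor C D G + H: is_functor C D H
        + K: is_functor C D K
      by (simp_all add: functor_category_def)
    have "\<And>A. A \<in> Obj C \<Longrightarrow> \<alpha> A \<in> Hom D (fob F A) (fob G A)"
      "\<And>A. A \<in> Obj C \<Longrightarrow> \<beta> A \<in> Hom D (fob G A) (fob H A)"
      "\<And>A. A \<in> Obj C \<Longrightarrow> \<gamma> A \<in> Hom D (fob H A) (fob K A)"
      using nat by (auto simp: functor_category_def)
    then show "Comp (functor_category C D) F H K \<gamma> (Comp (functor_category C D) F G H \<beta> \<alpha>)
        = Comp (functor_category C D) F G K (Comp (functor_category C D) G H K \<gamma> \<beta>) \<alpha>"
      by (auto simp: functor_category_def fun_eq_iff restrict_def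
          intro!: D.Comp_assoc F.fob_in_Obj G.fob_in_Obj H.fob_in_Obj K.fob_in_Obj)
  qed
qed

text \<open>This is why applying a functor degreewise sends simplicial objects to simplicial
  objects.\<close>

lemma is_functor_comp_functor:
  assumes "is_functor C D F" and "is_functor D E G"
  shows "is_functor C E (comp_functor G F)"
proof -
  interpret F: is_functor C D F by fact
  interpret G: is_functor D E G by fact
  show ?thesis
    by unfold_locales
      (simp_all add: comp_functor_def F.fob_in_Obj F.far_in_Hom F.far_Ident F.far_Comp
        G.fob_in_Obj G.far_in_Hom G.far_Ident G.far_Comp)
qed

section \<open>Ordinals, sets, monoids and convex monoids\<close>

lemma compose_ident_right: "f \<in> A \<rightarrow>\<^sub>E B \<Longrightarrow> compose A f (\<lambda>x \<in> A. x) = f"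
  by (rule extensionalityI[of _ A]) (auto simp: compose_def PiE_def)

lemma compose_ident_left: "f \<in> A \<rightarrow>\<^sub>E B \<Longrightarrow> compose A (\<lambda>x \<in> B. x) f = f"
  by (rule extensionalityI[of _ A]) (auto simp: compose_def PiE_def)

lemma compose_in_PiE: "f \<in> A \<rightarrow>\<^sub>E B \<Longrightarrow> g \<in> B \<rightarrow>\<^sub>E D \<Longrightarrow> compose A g f \<in> A \<rightarrow>\<^sub>E D"
  by (auto simp: compose_def)

lemma compose_assoc_PiE:
  "f \<in> A \<rightarrow>\<^sub>E B \<Longrightarrow> compose A h (compose A g f) = compose A (compose B h g) f"
  by (rule extensionalityI[of _ A]) (auto simp: compose_def)

lemma category_Delta: "category Delta"
proof
  fix l m n :: nat and f g
  assume "f \<in> Hom Delta l m" and "g \<in> Hom Delta m n"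
  then have f: "f \<in> {..l} \<rightarrow>\<^sub>E {..m}" "mono_on {..l} f"
    and g: "g \<in> {..m} \<rightarrow>\<^sub>E {..n}" "mono_on {..m} g"
    by (simp_all add: Delta_def)
  have "mono_on {..l} (compose {..l} g f)"
  proof (rule mono_onI)
    fix i j assume ij: "i \<in> {..l}" "j \<in> {..l}" "i \<le> j"
    have "g (f i) \<le> g (f j)"
      by (rule mono_onD[OF g(2) PiE_mem[OF f(1) ij(1)] PiE_mem[OF f(1) ij(2)] mono_onD[OF f(2) ij]])
    then show "compose {..l} g f i \<le> compose {..l} g f j"
      using ij by (simp add: compose_def)
  qed
  then show "Comp Delta l m n g f \<in> Hom Delta l n"
    using compose_in_PiE[OF f(1) g(1)] by (simp add: Delta_def)
qed (auto simp: Delta_def compose_ident_right compose_ident_left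
    intro!: mono_onI compose_assoc_PiE)

lemma category_Set: "category Set_cat"
proof
  fix A B D :: "'a set" and f g
  assume "f \<in> Hom Set_cat A B" "g \<in> Hom Set_cat B D"
  then show "Comp Set_cat A B D g f \<in> Hom Set_cat A D"
    using compose_in_PiE[of f A B g D] by (simp add: Set_cat_def)
qed (auto simp: Set_cat_def compose_ident_right compose_ident_left intro!: compose_assoc_PiE)

text \<open>\<open>compose\<close> agrees with the plain composite only on \<open>carrier L\<close>,
  so products and the unit of \<open>L\<close> must be known to lie there.\<close>

lemma monoid_hom_compose:
  assumes "f \<in> monoid_hom L M" and "g \<in> monoid_hom M N" and "monoid L"
  shows "compose (carrier L) g f \<in> monoid_hom L N"
proof -
  interpret monoid L by fact
  show ?thesis
    using assms(1,2) by (auto simp: monoid_hom_def hom_def compose_def Pi_iff)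
qed

lemma monoid_hom_ident: "monoid M \<Longrightarrow> (\<lambda>x \<in> carrier M. x) \<in> monoid_hom M M"
  by (auto simp: monoid_hom_def hom_def monoid.m_closed monoid.one_closed)

lemma category_Mon: "category Mon_cat"
proof
  fix A B D :: "'a monoid" and f g
  assume "A \<in> Obj Mon_cat" "f \<in> Hom Mon_cat A B" "g \<in> Hom Mon_cat B D"
  then show "Comp Mon_cat A B D g f \<in> Hom Mon_cat A D"
    using compose_in_PiE[of f "carrier A" "carrier B" g "carrier D"] monoid_hom_compose[of f A B g D]
    by (simp add: Mon_cat_def)
qed (auto simp: Mon_cat_def compose_ident_right compose_ident_left monoid_hom_ident
    intro!: compose_assoc_PiE)

lemma (in convex_monoid) conv_closed: "p \<in> Dset (carrier M) \<Longrightarrow> conv M p \<in> carrier M"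
  using conv_hom by (auto simp: monoid_hom_def Dmonoid_def hom_def)

lemma (in convex_monoid) conv_Dconv:
  "p \<in> Dset (carrier M) \<Longrightarrow> q \<in> Dset (carrier M) \<Longrightarrow>
    conv M (Dconv M p q) = conv M p \<otimes> conv M q"
  using conv_hom by (auto simp: monoid_hom_def Dmonoid_def hom_def)

lemma category_ConvMon: "category ConvMon_cat"
proof
  fix A :: "('a, 'b) convex_monoid"
  assume A: "A \<in> Obj ConvMon_cat"
  then interpret A: convex_monoid A by (simp add: ConvMon_cat_def)
  show "Ident ConvMon_cat A \<in> Hom ConvMon_cat A A"
    by (auto simp: ConvMon_cat_def monoid_hom_ident A.monoid_axioms A.conv_closed
        intro!: arg_cong[where f = "conv A"] Dmap_ident)
next
  fix A B D :: "('a, 'b) convex_monoid" and f g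
  assume A: "A \<in> Obj ConvMon_cat" and f: "f \<in> Hom ConvMon_cat A B"
    and g: "g \<in> Hom ConvMon_cat B D"
  then interpret A: convex_monoid A by (simp add: ConvMon_cat_def)
  have fg: "f \<in> carrier A \<rightarrow>\<^sub>E carrier B" "g \<in> carrier B \<rightarrow>\<^sub>E carrier D"
    using f g by (auto simp: ConvMon_cat_def)
  have "conv D (Dmap (compose (carrier A) g f) p) = compose (carrier A) g f (conv A p)"
    if p: "p \<in> Dset (carrier A)" for p
  proof -
    \<comment> \<open>The compatibility of \<open>g\<close> is applied at the push-forward
      \<open>Dmap f p\<close>, which must therefore be a distribution on
      \<open>carrier B\<close>.\<close>
    have fp: "Dmap f p \<in> Dset (carrier B)"
      using p fg by (intro Dmap_in_Dset[OF p]) auto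
    have "Dmap (compose (carrier A) g f) p = Dmap g (Dmap f p)"
      unfolding Dmap_Dmap[OF p] by (intro Dmap_cong[OF p]) (simp add: compose_def)
    then show ?thesis
      using f g p fp by (simp add: ConvMon_cat_def compose_def A.conv_closed)
  qed
  then show "Comp ConvMon_cat A B D g f \<in> Hom ConvMon_cat A D"
    using f g compose_in_PiE[OF fg] monoid_hom_compose[of f A B g D] A.monoid_axioms
    by (simp add: ConvMon_cat_def)
qed (auto simp: ConvMon_cat_def compose_ident_right compose_ident_left
    intro!: compose_assoc_PiE)

lemma category_sSet: "category sSet_cat"
  unfolding sSet_cat_def simplicial_category_def
  by (intro category_functor_category category_opposite category_Delta category_Set)

lemma category_sConvMon: "category sConvMon_cat"
  unfolding sConvMon_cat_def simplicial_category_def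
  by (intro category_functor_category category_opposite category_Delta category_ConvMon)

section \<open>The free convex monoid on a monoid\<close>

lemma free_convex_simps:
  "carrier (fob free_convex M) = Dset (carrier M)"
  "mult (fob free_convex M) = Dconv M"
  "one (fob free_convex M) = delta \<one>\<^bsub>M\<^esub>"
  "conv (fob free_convex M) = mu"
  "far free_convex M N f = restrict (Dmap f) (Dset (carrier M))"
  by (simp_all add: free_convex_def)

text \<open>The structure map is \<open>mu\<close>: its algebra laws are the monad laws
  \<open>mu_delta\<close> and \<open>mu_Dmap_mu\<close>, and its multiplicativity is
  \<open>mu_Dconv\<close>.\<close>

lemma convex_monoid_free_convex:
  fixes M :: "'a monoid"
  assumes "monoid M"
  shows "convex_monoid
    (fob free_convex M :: ('a \<Rightarrow> 'r::{comm_semiring_0, comm_monoid_mult}, 'r) convex_monoid)"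
    (is "convex_monoid ?F")
proof -
  interpret monoid M by fact
  show ?thesis
  proof
    show "conv ?F \<in> monoid_hom (Dmonoid ?F) ?F"
      unfolding monoid_hom_def hom_def Dmonoid_def
      by (simp add: free_convex_simps mu_in_Dset mu_Dconv[OF _ _ free_convex_simps(2)] Pi_iff)
    show "conv ?F (Dmap (conv ?F) P) = conv ?F (mu P)"
      if "P \<in> Dset (Dset (carrier ?F))" for P :: "(('a \<Rightarrow> 'r) \<Rightarrow> 'r) \<Rightarrow> 'r"
      using that by (auto simp: free_convex_simps intro: mu_Dmap_mu)
  qed (simp_all add: free_convex_simps Dconv_in_Dset delta_in_Dset Dconv_assoc
      Dconv_delta_one_left Dconv_delta_one_right)
qed

lemma is_functor_free_convex:
  "is_functor Mon_cat (ConvMon_cat ::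
    (('a \<Rightarrow> 'r::{comm_semiring_0, comm_monoid_mult}, 'r) convex_monoid, _) category) free_convex"
  (is "is_functor _ ?D _")
proof -
  interpret Mon: category Mon_cat by (rule category_Mon)
  interpret ConvMon: category ?D by (rule category_ConvMon)
  show ?thesis
  proof
    show "fob free_convex M \<in> Obj ?D" if "M \<in> Obj Mon_cat" for M
      using that convex_monoid_free_convex by (simp add: Mon_cat_def ConvMon_cat_def)
  next
    fix M N :: "'a monoid" and f
    assume "M \<in> Obj Mon_cat" and "f \<in> Hom Mon_cat M N"
    then interpret monoid M by (simp add: Mon_cat_def)
    have f: "f \<in> hom M N" "f \<one>\<^bsub>M\<^esub> = \<one>\<^bsub>N\<^esub>" "\<And>x. x \<in> carrier M \<Longrightarrow> f x \<in> carrier N"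
      using \<open>f \<in> Hom Mon_cat M N\<close> by (auto simp: Mon_cat_def monoid_hom_def)
    \<comment> \<open>Compatibility with the structure maps is naturality of \<open>mu\<close>; the
      restriction is harmless because \<open>P\<close> is supported on
      \<open>Dset (carrier M)\<close>.\<close>
    have "mu (Dmap (restrict (Dmap f) (Dset (carrier M))) P) = Dmap f (mu P)"
      if P: "P \<in> Dset (Dset (carrier M) :: ('a \<Rightarrow> 'r) set)" for P :: "('a \<Rightarrow> 'r) \<Rightarrow> 'r"
      using Dmap_cong[OF P, of "restrict (Dmap f) (Dset (carrier M))" "Dmap f"]
        Dmap_mu[OF P, of f] by simp
    moreover have "restrict (Dmap f) (Dset (carrier M))
        \<in> monoid_hom (fob free_convex M :: ('a \<Rightarrow> 'r, 'r) convex_monoid) (fob free_convex N)"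
      using f by (auto simp: monoid_hom_def hom_def[of "fob free_convex M"] free_convex_simps
          Dconv_in_Dset delta_in_Dset Dmap_Dconv intro: Dmap_in_Dset)
    ultimately show "far free_convex M N f \<in> Hom ?D (fob free_convex M) (fob free_convex N)"
      using f by (auto simp: ConvMon_cat_def free_convex_simps mu_in_Dset intro: Dmap_in_Dset)
  next
    fix M :: "'a monoid"
    show "far free_convex M M (Ident Mon_cat M) = Ident ?D (fob free_convex M)"
      by (auto simp: ConvMon_cat_def Mon_cat_def free_convex_simps intro!: restrict_ext Dmap_ident)
  next
    fix L M N :: "'a monoid" and f g
    assume f: "f \<in> Hom Mon_cat L M"
    have f': "\<And>x. x \<in> carrier L \<Longrightarrow> f x \<in> carrier M"
      using f by (auto simp: Mon_cat_def)
    show "far free_convex L N (Comp Mon_cat L M N g f)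
        = Comp ?D (fob free_convex L) (fob free_convex M) (fob free_convex N)
            (far free_convex M N g) (far free_convex L M f)"
    proof
      fix p
      show "far free_convex L N (Comp Mon_cat L M N g f) p
        = Comp ?D (fob free_convex L) (fob free_convex M) (fob free_convex N)
            (far free_convex M N g) (far free_convex L M f) p"
      \<comment> \<open>Off \<open>Dset (carrier L)\<close> both sides are
        \<open>undefined\<close>.\<close>
      proof (cases "p \<in> Dset (carrier L)")
        case True
        then show ?thesis
          using Dmap_in_Dset[OF True f'] Dmap_Dmap[OF True, of g f]
            Dmap_cong[OF True, of "compose (carrier L) g f" "\<lambda>x. g (f x)"]
          by (simp add: ConvMon_cat_def Mon_cat_def free_convex_simps compose_def)
      qed (simp add: ConvMon_cat_def Mon_cat_def free_convex_simps compose_def)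
    qed
  qed
qed

section \<open>Mapping monoids\<close>

lemma underlying_sset_simps:
  "fob (underlying_sset Y) n = carrier (fob Y n)"
  "far (underlying_sset Y) m n \<theta> = far Y m n \<theta>"
  by (simp_all add: degreewise_def comp_functor_def forget_def)

lemma smap_iff:
  "\<phi> \<in> smap X Y \<longleftrightarrow> (\<forall>n. \<phi> n \<in> fob X n \<rightarrow>\<^sub>E fob Y n) \<and>
    (\<forall>m n. \<forall>\<theta> \<in> Hom Delta m n. \<forall>x \<in> fob X n. \<phi> m (far X n m \<theta> x) = far Y n m \<theta> (\<phi> n x))"
  by (auto simp: smap_def compose_def fun_eq_iff restrict_def)

text \<open>The three simplicial sets may have simplices in different types, so this is not an
  instance of composition in \<open>sSet_cat\<close>. The last assumption keeps
  \<open>far X n m \<theta> x\<close> inside the domain on which the composite is defined.\<close>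

lemma smap_comp_in_smap:
  assumes "\<phi> \<in> smap X Y" and "\<psi> \<in> smap Y Z"
    and "\<And>m n \<theta> x. \<theta> \<in> Hom Delta m n \<Longrightarrow> x \<in> fob X n \<Longrightarrow> far X n m \<theta> x \<in> fob X m"
  shows "smap_comp X \<psi> \<phi> \<in> smap X Z"
proof -
  have \<phi>: "\<phi> n \<in> fob X n \<rightarrow>\<^sub>E fob Y n" and \<psi>: "\<psi> n \<in> fob Y n \<rightarrow>\<^sub>E fob Z n" for n
    using assms(1,2) by (auto simp: smap_iff)
  show ?thesis
    unfolding smap_iff smap_comp_def
  proof (intro conjI allI ballI)
    show "compose (fob X n) (\<psi> n) (\<phi> n) \<in> fob X n \<rightarrow>\<^sub>E fob Z n" for n
      by (rule compose_in_PiE[OF \<phi> \<psi>])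
    fix m n \<theta> x assume "\<theta> \<in> Hom Delta m n" "x \<in> fob X n"
    moreover from this have "\<phi> n x \<in> fob Y n"
      using \<phi> by auto
    ultimately show "compose (fob X m) (\<psi> m) (\<phi> m) (far X n m \<theta> x)
        = far Z n m \<theta> (compose (fob X n) (\<psi> n) (\<phi> n) x)"
      using assms by (simp add: smap_iff compose_def)
  qed
qed

lemma sset_far_closed:
  assumes "X \<in> Obj sSet_cat" and "\<theta> \<in> Hom Delta m n" and "x \<in> fob X n"
  shows "far X n m \<theta> x \<in> fob X m"
proof -
  interpret is_functor "opposite Delta" Set_cat X
    using assms(1) by (simp add: sSet_cat_def simplicial_category_def functor_category_def)
  have "far X n m \<theta> \<in> Hom Set_cat (fob X n) (fob X m)"
    using assms(2) by (intro far_in_Hom) (simp_all add: opposite_def Delta_def)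
  then show ?thesis
    using assms(3) by (auto simp: Set_cat_def)
qed

lemma sConvMon_far_in_Hom:
  assumes "Y \<in> Obj sConvMon_cat" and "\<theta> \<in> Hom Delta m n"
  shows "far Y n m \<theta> \<in> Hom ConvMon_cat (fob Y n) (fob Y m)"
proof -
  interpret is_functor "opposite Delta" ConvMon_cat Y
    using assms(1) by (simp add: sConvMon_cat_def simplicial_category_def functor_category_def)
  show ?thesis
    using assms(2) by (intro far_in_Hom) (simp_all add: opposite_def Delta_def)
qed

lemma sConvMon_convex_monoid:
  assumes "Y \<in> Obj sConvMon_cat" shows "convex_monoid (fob Y n)"
proof -
  interpret is_functor "opposite Delta" ConvMon_cat Y
    using assms by (simp add: sConvMon_cat_def simplicial_category_def functor_category_def)
  have "fob Y n \<in> Obj ConvMon_cat"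
    by (rule fob_in_Obj) (simp add: opposite_def Delta_def)
  then show ?thesis
    by (simp add: ConvMon_cat_def)
qed

section \<open>The convex monoid of simplicial maps\<close>

locale mapping_space =
  fixes X :: "'x sset"
    and Y :: "('y, 'r::{comm_semiring_0, comm_monoid_mult}) sconvex_monoid"
  assumes X: "X \<in> Obj sSet_cat" and Y: "Y \<in> Obj sConvMon_cat"
begin

abbreviation H :: "(nat \<Rightarrow> 'x \<Rightarrow> 'y, 'r) convex_monoid" where
  "H \<equiv> mapping_convex_monoid X Y"

sublocale Y: convex_monoid "fob Y n" for n
  by (rule sConvMon_convex_monoid[OF Y])

lemmas far_X_closed = sset_far_closed[OF X]

lemma far_Y:
  assumes "\<theta> \<in> Hom Delta m n"
  shows "far Y n m \<theta> \<in> hom (fob Y n) (fob Y m)"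
    and "far Y n m \<theta> \<one>\<^bsub>fob Y n\<^esub> = \<one>\<^bsub>fob Y m\<^esub>"
    and "p \<in> Dset (carrier (fob Y n)) \<Longrightarrow>
      conv (fob Y m) (Dmap (far Y n m \<theta>) p) = far Y n m \<theta> (conv (fob Y n) p)"
  using sConvMon_far_in_Hom[OF Y assms] by (auto simp: ConvMon_cat_def monoid_hom_def)

lemma carrier_H_iff:
  "\<phi> \<in> carrier H \<longleftrightarrow> (\<forall>n. \<phi> n \<in> extensional (fob X n)) \<and>
    (\<forall>n. \<forall>x \<in> fob X n. \<phi> n x \<in> carrier (fob Y n)) \<and>
    (\<forall>m n. \<forall>\<theta> \<in> Hom Delta m n. \<forall>x \<in> fob X n. \<phi> m (far X n m \<theta> x) = far Y n m \<theta> (\<phi> n x))"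
  by (auto simp: mapping_convex_monoid_def smap_iff underlying_sset_simps PiE_iff)

lemma eval_closed: "\<phi> \<in> carrier H \<Longrightarrow> x \<in> fob X n \<Longrightarrow> \<phi> n x \<in> carrier (fob Y n)"
  by (simp add: carrier_H_iff)

text \<open>Evaluations at simplices are jointly injective on the carrier, since its members are
  extensional. Every law of \<open>H\<close> can thus be checked in a single level of
  \<open>Y\<close>.\<close>

lemma H_eqI:
  assumes "\<phi> \<in> carrier H" and "\<psi> \<in> carrier H"
    and "\<And>n x. x \<in> fob X n \<Longrightarrow> \<phi> n x = \<psi> n x"
  shows "\<phi> = \<psi>"
proof
  show "\<phi> n = \<psi> n" for n
    using assms by (intro extensionalityI[of _ "fob X n"]) (auto simp: carrier_H_iff)
qed

lemma eval_mult: "x \<in> fob X n \<Longrightarrow> (\<phi> \<otimes>\<^bsub>H\<^esub> \<psi>) n x = \<phi> n x \<otimes>\<^bsub>fob Y n\<^esub> \<psi> n x"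
  by (simp add: mapping_convex_monoid_def)

lemma eval_one: "x \<in> fob X n \<Longrightarrow> \<one>\<^bsub>H\<^esub> n x = \<one>\<^bsub>fob Y n\<^esub>"
  by (simp add: mapping_convex_monoid_def)

text \<open>The pointwise product is again simplicial because the simplicial operators of
  \<open>Y\<close> are multiplicative.\<close>

lemma mult_closed:
  assumes "\<phi> \<in> carrier H" and "\<psi> \<in> carrier H"
  shows "\<phi> \<otimes>\<^bsub>H\<^esub> \<psi> \<in> carrier H"
  unfolding carrier_H_iff
proof (intro conjI allI ballI)
  show "(\<phi> \<otimes>\<^bsub>H\<^esub> \<psi>) n \<in> extensional (fob X n)" for n
    by (simp add: mapping_convex_monoid_def)
  show "(\<phi> \<otimes>\<^bsub>H\<^esub> \<psi>) n x \<in> carrier (fob Y n)" if "x \<in> fob X n" for n x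
    using that assms by (simp add: eval_mult eval_closed)
  show "(\<phi> \<otimes>\<^bsub>H\<^esub> \<psi>) m (far X n m \<theta> x) = far Y n m \<theta> ((\<phi> \<otimes>\<^bsub>H\<^esub> \<psi>) n x)"
    if "\<theta> \<in> Hom Delta m n" "x \<in> fob X n" for m n \<theta> x
    using that assms far_Y(1)[OF that(1)]
    by (simp add: eval_mult far_X_closed hom_mult carrier_H_iff)
qed

lemma one_closed: "\<one>\<^bsub>H\<^esub> \<in> carrier H"
  unfolding carrier_H_iff
proof (intro conjI allI ballI)
  show "\<one>\<^bsub>H\<^esub> n \<in> extensional (fob X n)" for n
    by (simp add: mapping_convex_monoid_def)
qed (simp_all add: eval_one far_X_closed far_Y)

lemma monoid_H: "monoid H"
proof
  fix \<phi> \<psi> \<chi> assume "\<phi> \<in> carrier H" "\<psi> \<in> carrier H" "\<chi> \<in> carrier H"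
  then show "\<phi> \<otimes>\<^bsub>H\<^esub> \<psi> \<otimes>\<^bsub>H\<^esub> \<chi> = \<phi> \<otimes>\<^bsub>H\<^esub> (\<psi> \<otimes>\<^bsub>H\<^esub> \<chi>)"
    by (intro H_eqI mult_closed) (simp_all add: eval_mult eval_closed Y.m_assoc)
next
  fix \<phi> assume "\<phi> \<in> carrier H"
  then show "\<one>\<^bsub>H\<^esub> \<otimes>\<^bsub>H\<^esub> \<phi> = \<phi>" "\<phi> \<otimes>\<^bsub>H\<^esub> \<one>\<^bsub>H\<^esub> = \<phi>"
    by (auto intro!: H_eqI mult_closed one_closed simp: eval_mult eval_one eval_closed)
qed (simp_all add: mult_closed one_closed)

lemma Dmap_eval_in_Dset:
  "d \<in> Dset (carrier H) \<Longrightarrow> x \<in> fob X n \<Longrightarrow> Dmap (\<lambda>\<phi>. \<phi> n x) d \<in> Dset (carrier (fob Y n))"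
  by (rule Dmap_in_Dset) (auto intro: eval_closed)

text \<open>The interface to the structure map: the definition of \<open>Theta\<close> is not opened
  again. That \<open>d\<close> lives on the carrier of \<open>H\<close> puts its push-forward into
  the domain to which \<open>sconv\<close> is restricted.\<close>

lemma eval_conv:
  assumes d: "d \<in> Dset (carrier H)" and x: "x \<in> fob X n"
  shows "conv H d n x = conv (fob Y n) (Dmap (\<lambda>\<phi>. \<phi> n x) d)"
proof -
  have "Theta X d n x = Dmap (\<lambda>\<phi>. \<phi> n x) d"
    using x by (simp add: Theta_def Dmap_eq_Dbind DsetD(1)[OF d] Dbind_def Dint_def)
  then show ?thesis
    using x Dmap_eval_in_Dset[OF d x]
    by (simp add: mapping_convex_monoid_def smap_comp_def compose_def sconv_def)
qed

lemma conv_closed: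
  assumes d: "d \<in> Dset (carrier H)" shows "conv H d \<in> carrier H"
  unfolding carrier_H_iff
proof (intro conjI allI ballI)
  show "conv H d n \<in> extensional (fob X n)" for n
    by (simp add: mapping_convex_monoid_def smap_comp_def)
  show "conv H d n x \<in> carrier (fob Y n)" if "x \<in> fob X n" for n x
    using that d by (simp add: eval_conv Y.conv_closed Dmap_eval_in_Dset)
  fix m n \<theta> x assume \<theta>: "\<theta> \<in> Hom Delta m n" and x: "x \<in> fob X n"
  \<comment> \<open>Every \<open>\<phi>\<close> in the support of \<open>d\<close> is simplicial, so
    evaluating at \<open>far X n m \<theta> x\<close> is evaluating at \<open>x\<close> and then
    applying the operator of \<open>Y\<close>. That operator is a morphism of convex monoids and
    passes through \<open>conv\<close>.\<close>
  have "Dmap (\<lambda>\<phi>. \<phi> m (far X n m \<theta> x)) d = Dmap (\<lambda>\<phi>. far Y n m \<theta> (\<phi> n x)) d"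
    using \<theta> x by (intro Dmap_cong[OF d]) (simp add: carrier_H_iff)
  also have "\<dots> = Dmap (far Y n m \<theta>) (Dmap (\<lambda>\<phi>. \<phi> n x) d)"
    by (simp add: Dmap_Dmap[OF d])
  finally show "conv H d m (far X n m \<theta> x) = far Y n m \<theta> (conv H d n x)"
    using \<theta> x d by (simp add: eval_conv far_X_closed far_Y(3) Dmap_eval_in_Dset)
qed

lemma convex_monoid_H: "convex_monoid H"
proof -
  interpret monoid H by (rule monoid_H)
  show ?thesis
  proof
    have "conv H (Dconv H p q) = conv H p \<otimes>\<^bsub>H\<^esub> conv H q"
      if p: "p \<in> Dset (carrier H)" and q: "q \<in> Dset (carrier H)" for p q
    proof (rule H_eqI)
      fix n x assume x: "x \<in> fob X n"
      \<comment> \<open>Evaluation is multiplicative, so by \<open>Dmap_Dconv\<close> it carries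
        convolution over \<open>H\<close> to convolution over \<open>fob Y n\<close>.\<close>
      have "(\<lambda>\<phi>. \<phi> n x) \<in> hom H (fob Y n)"
        using x by (auto simp: hom_def eval_mult eval_closed)
      then show "conv H (Dconv H p q) n x = (conv H p \<otimes>\<^bsub>H\<^esub> conv H q) n x"
        using p q x
        by (simp add: eval_conv Dconv_in_Dset eval_mult Dmap_Dconv Y.conv_Dconv Dmap_eval_in_Dset)
    qed (simp_all add: p q conv_closed Dconv_in_Dset)
    moreover have "conv H (delta \<one>\<^bsub>H\<^esub>) = \<one>\<^bsub>H\<^esub>"
      by (rule H_eqI)
        (simp_all add: conv_closed delta_in_Dset eval_conv eval_one Y.conv_delta)
    ultimately show "conv H \<in> monoid_hom (Dmonoid H) H"
      by (simp add: monoid_hom_def hom_def Dmonoid_def conv_closed)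
  next
    fix \<phi> assume \<phi>: "\<phi> \<in> carrier H"
    then show "conv H (delta \<phi>) = \<phi>"
      by (intro H_eqI)
        (simp_all add: conv_closed delta_in_Dset eval_conv eval_closed Y.conv_delta)
  next
    fix P :: "((nat \<Rightarrow> 'x \<Rightarrow> 'y) \<Rightarrow> 'r) \<Rightarrow> 'r"
    assume P: "P \<in> Dset (Dset (carrier H))"
    have conv_P: "Dmap (conv H) P \<in> Dset (carrier H)"
      by (rule Dmap_in_Dset[OF P]) (rule conv_closed)
    show "conv H (Dmap (conv H) P) = conv H (mu P)"
    proof (rule H_eqI)
      fix n x assume x: "x \<in> fob X n"
      let ?ev = "\<lambda>\<phi>. \<phi> n x"
      have ev_P: "Dmap (Dmap ?ev) P \<in> Dset (Dset (carrier (fob Y n)))"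
        by (rule Dmap_in_Dset[OF P]) (rule Dmap_eval_in_Dset[OF _ x])
      \<comment> \<open>Evaluation passes inside: averaging in \<open>H\<close> and then evaluating
        is evaluating and then averaging in \<open>fob Y n\<close>. The algebra law of
        \<open>fob Y n\<close> and naturality of \<open>mu\<close> finish the argument.\<close>
      have "Dmap ?ev (Dmap (conv H) P) = Dmap (\<lambda>d. conv (fob Y n) (Dmap ?ev d)) P"
        unfolding Dmap_Dmap[OF P] by (rule Dmap_cong[OF P]) (simp add: eval_conv x)
      also have "\<dots> = Dmap (conv (fob Y n)) (Dmap (Dmap ?ev) P)"
        by (simp add: Dmap_Dmap[OF P])
      finally have "conv H (Dmap (conv H) P) n x = conv (fob Y n) (mu (Dmap (Dmap ?ev) P))"
        using x by (simp add: eval_conv[OF conv_P] Y.conv_mu[OF ev_P])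
      then show "conv H (Dmap (conv H) P) n x = conv H (mu P) n x"
        using x by (simp add: eval_conv mu_in_Dset[OF P] Dmap_mu[OF P])
    qed (simp_all add: conv_closed conv_P mu_in_Dset[OF P])
  qed
qed

end

section \<open>Functoriality in both arguments\<close>

lemma sConvMon_arrow:
  assumes "g \<in> Hom sConvMon_cat Y Y'"
  shows "g n \<in> Hom ConvMon_cat (fob Y n) (fob Y' n)"
    and "g \<in> smap (underlying_sset Y) (underlying_sset Y')"
proof -
  show g: "g n \<in> Hom ConvMon_cat (fob Y n) (fob Y' n)" for n
    using assms
    by (auto simp: sConvMon_cat_def simplicial_category_def functor_category_def opposite_def
        Delta_def)
  show "g \<in> smap (underlying_sset Y) (underlying_sset Y')"
    unfolding smap_def mem_Collect_eq underlying_sset_simps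
  proof (intro conjI allI ballI)
    show "g n \<in> carrier (fob Y n) \<rightarrow>\<^sub>E carrier (fob Y' n)" for n
      using g[of n] by (simp add: ConvMon_cat_def)
    show "compose (carrier (fob Y n)) (g m) (far Y n m \<theta>)
        = compose (carrier (fob Y n)) (far Y' n m \<theta>) (g n)" if "\<theta> \<in> Hom Delta m n" for m n \<theta>
      using assms that
      by (simp add: sConvMon_cat_def simplicial_category_def functor_category_def opposite_def
          Delta_def ConvMon_cat_def)
  qed
qed

lemma smap_comp_in_Hom:
  fixes X X' :: "'x sset"
    and Y Y' :: "('y, 'r::{comm_semiring_0, comm_monoid_mult}) sconvex_monoid"
  assumes "X \<in> Obj sSet_cat" and "X' \<in> Obj sSet_cat"
    and "Y \<in> Obj sConvMon_cat" and "Y' \<in> Obj sConvMon_cat"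
    and f: "f \<in> Hom sSet_cat X' X" and g: "g \<in> Hom sConvMon_cat Y Y'"
  shows "(\<lambda>\<phi> \<in> smap X (underlying_sset Y). smap_comp X' g (smap_comp X' \<phi> f))
    \<in> Hom ConvMon_cat (mapping_convex_monoid X Y) (mapping_convex_monoid X' Y')"
    (is "?F \<in> _")
proof -
  interpret A: mapping_space X Y by standard fact+
  interpret B: mapping_space X' Y' by standard fact+
  have carrier: "carrier A.H = smap X (underlying_sset Y)"
    "carrier B.H = smap X' (underlying_sset Y')"
    by (simp_all add: mapping_convex_monoid_def)
  have f': "f \<in> smap X' X" and f_closed: "\<And>n x. x \<in> fob X' n \<Longrightarrow> f n x \<in> fob X n"
    using f unfolding smap_eq_Hom[symmetric] by (auto simp: smap_iff)
  note g' = sConvMon_arrow[OF g]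
  \<comment> \<open>Evaluating the image at \<open>x\<close> is evaluating \<open>\<phi>\<close> at
    \<open>f n x\<close> and applying \<open>g n\<close>. Each morphism law below is therefore the
    corresponding law of \<open>g n\<close>, read at the simplex \<open>f n x\<close>.\<close>
  have eval_F: "?F \<phi> n x = g n (\<phi> n (f n x))" if "\<phi> \<in> carrier A.H" "x \<in> fob X' n" for \<phi> n x
    using that by (simp add: carrier smap_comp_def compose_def)
  have F_closed: "?F \<phi> \<in> carrier B.H" if "\<phi> \<in> carrier A.H" for \<phi>
    using that f' g'(2) by (auto simp: carrier intro!: smap_comp_in_smap B.far_X_closed)
  have g_hom: "g n \<in> hom (fob Y n) (fob Y' n)" "g n \<one>\<^bsub>fob Y n\<^esub> = \<one>\<^bsub>fob Y' n\<^esub>"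
    "\<And>p. p \<in> Dset (carrier (fob Y n)) \<Longrightarrow> conv (fob Y' n) (Dmap (g n) p) = g n (conv (fob Y n) p)"
    for n
    using g'(1)[of n] by (auto simp: ConvMon_cat_def monoid_hom_def)
  have F_ext: "?F \<in> extensional (carrier A.H)"
    by (simp add: carrier)
  have "?F (\<phi> \<otimes>\<^bsub>A.H\<^esub> \<psi>) = ?F \<phi> \<otimes>\<^bsub>B.H\<^esub> ?F \<psi>"
    if \<phi>: "\<phi> \<in> carrier A.H" and \<psi>: "\<psi> \<in> carrier A.H" for \<phi> \<psi>
  proof (rule B.H_eqI)
    show "?F (\<phi> \<otimes>\<^bsub>A.H\<^esub> \<psi>) n x = (?F \<phi> \<otimes>\<^bsub>B.H\<^esub> ?F \<psi>) n x" if "x \<in> fob X' n" for n x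
      unfolding B.eval_mult[OF that] eval_F[OF \<phi> that] eval_F[OF \<psi> that]
        eval_F[OF A.mult_closed[OF \<phi> \<psi>] that] A.eval_mult[OF f_closed[OF that]]
      by (intro hom_mult[OF g_hom(1)] A.eval_closed \<phi> \<psi> f_closed that)
  qed (intro F_closed A.mult_closed B.mult_closed \<phi> \<psi>)+
  moreover have "?F \<one>\<^bsub>A.H\<^esub> = \<one>\<^bsub>B.H\<^esub>"
  proof (rule B.H_eqI)
    show "?F \<one>\<^bsub>A.H\<^esub> n x = \<one>\<^bsub>B.H\<^esub> n x" if "x \<in> fob X' n" for n x
      unfolding eval_F[OF A.one_closed that] A.eval_one[OF f_closed[OF that]] B.eval_one[OF that]
      by (rule g_hom)
  qed (intro F_closed A.one_closed B.one_closed)+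
  moreover have "conv B.H (Dmap ?F d) = ?F (conv A.H d)" if d: "d \<in> Dset (carrier A.H)" for d
  proof (rule B.H_eqI)
    have Fd: "Dmap ?F d \<in> Dset (carrier B.H)"
      by (rule Dmap_in_Dset[OF d F_closed])
    then show "conv B.H (Dmap ?F d) \<in> carrier B.H"
      by (rule B.conv_closed)
    show "?F (conv A.H d) \<in> carrier B.H"
      by (intro F_closed A.conv_closed d)
    fix n x assume x: "x \<in> fob X' n"
    have "Dmap (\<lambda>\<phi>. \<phi> n x) (Dmap ?F d) = Dmap (\<lambda>\<phi>. g n (\<phi> n (f n x))) d"
      unfolding Dmap_Dmap[OF d] by (rule Dmap_cong[OF d]) (rule eval_F[OF _ x])
    also have "\<dots> = Dmap (g n) (Dmap (\<lambda>\<phi>. \<phi> n (f n x)) d)"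
      by (simp add: Dmap_Dmap[OF d])
    finally show "conv B.H (Dmap ?F d) n x = ?F (conv A.H d) n x"
      unfolding B.eval_conv[OF Fd x] eval_F[OF A.conv_closed[OF d] x]
        A.eval_conv[OF d f_closed[OF x]]
      by (simp only: g_hom(3)[OF A.Dmap_eval_in_Dset[OF d f_closed[OF x]]])
  qed
  ultimately show ?thesis
    using F_closed F_ext unfolding ConvMon_cat_def monoid_hom_def hom_def by (simp add: PiE_iff)
qed

lemma sSet_hom_convex_simps:
  "fob sSet_hom_convex (X, Y) = mapping_convex_monoid X Y"
  "far sSet_hom_convex (X, Y) (X', Y') (f, g)
    = (\<lambda>\<phi> \<in> smap X (underlying_sset Y). smap_comp X' g (smap_comp X' \<phi> f))"
  by (simp_all add: sSet_hom_convex_def sSet_hom_def)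

lemma is_functor_sSet_hom_convex:
  "is_functor
    (prod_category (opposite (sSet_cat :: ('x sset, nat \<Rightarrow> 'x \<Rightarrow> 'x) category))
      (sConvMon_cat :: (('y, 'r::{comm_semiring_0, comm_monoid_mult}) sconvex_monoid,
                        nat \<Rightarrow> 'y \<Rightarrow> 'y) category))
    (ConvMon_cat :: ((nat \<Rightarrow> 'x \<Rightarrow> 'y, 'r) convex_monoid, _) category)
    sSet_hom_convex"
  (is "is_functor ?C ?D _")
proof -
  interpret C: category ?C
    by (intro category_prod category_opposite category_sSet category_sConvMon)
  interpret D: category ?D
    by (rule category_ConvMon)
  have Obj: "(X, Y) \<in> Obj ?C \<longleftrightarrow> X \<in> Obj sSet_cat \<and> Y \<in> Obj sConvMon_cat" for X Y
    by (simp add: prod_category_def opposite_def)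
  have Hom: "(f, g) \<in> Hom ?C (X, Y) (X', Y') \<longleftrightarrow> f \<in> Hom sSet_cat X' X \<and> g \<in> Hom sConvMon_cat Y Y'"
    for f g X Y X' Y'
    by (simp add: prod_category_def opposite_def)
  \<comment> \<open>Established before the functor axioms because it also supplies
    \<open>closed\<close> in the composition law.\<close>
  have far: "far sSet_hom_convex A B h \<in> Hom ?D (fob sSet_hom_convex A) (fob sSet_hom_convex B)"
    if "A \<in> Obj ?C" "B \<in> Obj ?C" "h \<in> Hom ?C A B" for A B h
  proof -
    obtain X Y X' Y' f g where eqs: "A = (X, Y)" "B = (X', Y')" "h = (f, g)"
      by (cases A; cases B; cases h)
    show ?thesis
      unfolding eqs sSet_hom_convex_simps
      by (rule smap_comp_in_Hom) (use that in \<open>simp_all add: eqs Obj Hom\<close>)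
  qed
  show ?thesis
  proof
    fix A assume A: "A \<in> Obj ?C"
    obtain X Y where XY: "A = (X, Y)" by (cases A)
    interpret mapping_space X Y
      using A by unfold_locales (simp_all add: XY Obj)
    show "fob sSet_hom_convex A \<in> Obj ?D"
      using convex_monoid_H by (simp add: XY sSet_hom_convex_simps ConvMon_cat_def)
    have "smap_comp X (\<lambda>n. \<lambda>y \<in> carrier (fob Y n). y) (smap_comp X \<phi> (\<lambda>n. \<lambda>x \<in> fob X n. x)) = \<phi>"
      if "\<phi> \<in> smap X (underlying_sset Y)" for \<phi>
    proof
      fix n
      have "\<phi> n \<in> fob X n \<rightarrow>\<^sub>E carrier (fob Y n)"
        using that unfolding smap_iff underlying_sset_simps by blast
      then show "smap_comp X (\<lambda>n. \<lambda>y \<in> carrier (fob Y n). y)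
          (smap_comp X \<phi> (\<lambda>n. \<lambda>x \<in> fob X n. x)) n = \<phi> n"
        by (simp add: smap_comp_def compose_ident_right compose_ident_left)
    qed
    \<comment> \<open>Every natural number is an object of \<open>Delta\<close>, so the normalising
      restriction of natural transformations is to \<open>UNIV\<close> and disappears.\<close>
    moreover have "Ident ?C A = (\<lambda>n. \<lambda>x \<in> fob X n. x, \<lambda>n. \<lambda>y \<in> carrier (fob Y n). y)"
      by (simp add: XY prod_category_def opposite_def sSet_cat_def sConvMon_cat_def Set_cat_def
          simplicial_category_def functor_category_def ConvMon_cat_def Delta_def
          restrict_UNIV)
    moreover have "Ident ?D (fob sSet_hom_convex A) = (\<lambda>\<phi> \<in> smap X (underlying_sset Y). \<phi>)"
      by (simp add: XY sSet_hom_convex_simps ConvMon_cat_def mapping_convex_monoid_def)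
    ultimately show "far sSet_hom_convex A A (Ident ?C A) = Ident ?D (fob sSet_hom_convex A)"
      by (simp add: XY sSet_hom_convex_simps cong: restrict_cong)
  next
    fix A B E h k
    assume A: "A \<in> Obj ?C" and B: "B \<in> Obj ?C" and E: "E \<in> Obj ?C"
      and h: "h \<in> Hom ?C A B" and k: "k \<in> Hom ?C B E"
    obtain X Y X' Y' X'' Y'' f g f' g' where
      eqs: "A = (X, Y)" "B = (X', Y')" "E = (X'', Y'')" "h = (f, g)" "k = (f', g')"
      by (cases A; cases B; cases E; cases h; cases k)
    have f: "f \<in> smap X' X" and f': "f' \<in> smap X'' X'"
      using h k by (simp_all add: eqs Hom smap_eq_Hom)
    \<comment> \<open>The first argument is contravariant: its component is \<open>f\<close> after
      \<open>f'\<close>.\<close>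
    have comp: "Comp ?C A B E k h
        = (smap_comp X'' f f', \<lambda>n. compose (carrier (fob Y n)) (g' n) (g n))"
      by (simp add: eqs prod_category_def opposite_def smap_comp_eq_Comp[symmetric])
        (simp add: sConvMon_cat_def simplicial_category_def functor_category_def
          ConvMon_cat_def Delta_def opposite_def restrict_UNIV)
    have closed: "smap_comp X' g (smap_comp X' \<phi> f) \<in> smap X' (underlying_sset Y')"
      if "\<phi> \<in> smap X (underlying_sset Y)" for \<phi>
      using far[OF A B h] that
      by (auto simp: eqs sSet_hom_convex_simps ConvMon_cat_def mapping_convex_monoid_def)
    have "smap_comp X'' (\<lambda>n. compose (carrier (fob Y n)) (g' n) (g n))
          (smap_comp X'' \<phi> (smap_comp X'' f f'))
        = smap_comp X'' g' (smap_comp X'' (smap_comp X' g (smap_comp X' \<phi> f)) f')"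
      if \<phi>: "\<phi> \<in> smap X (underlying_sset Y)" for \<phi>
    proof -
      \<comment> \<open>With these memberships every nested \<open>compose\<close> reduces, and both
        sides send \<open>x\<close> to \<open>g' n (g n (\<phi> n (f n (f' n x))))\<close>.\<close>
      have "f' n x \<in> fob X' n" "f n (f' n x) \<in> fob X n" "\<phi> n (f n (f' n x)) \<in> carrier (fob Y n)"
        if "x \<in> fob X'' n" for n x
      proof -
        show f'x: "f' n x \<in> fob X' n"
          using f' that by (auto simp: smap_iff)
        show ffx: "f n (f' n x) \<in> fob X n"
          using f f'x by (auto simp: smap_iff)
        show "\<phi> n (f n (f' n x)) \<in> carrier (fob Y n)"
          using \<phi> ffx unfolding smap_iff underlying_sset_simps by blast
      qed
      then show ?thesis
        by (simp add: smap_comp_def compose_def fun_eq_iff restrict_def)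
    qed
    then show "far sSet_hom_convex A E (Comp ?C A B E k h)
        = Comp ?D (fob sSet_hom_convex A) (fob sSet_hom_convex B) (fob sSet_hom_convex E)
            (far sSet_hom_convex B E k) (far sSet_hom_convex A B h)"
      unfolding comp unfolding eqs sSet_hom_convex_simps
      by (simp add: ConvMon_cat_def mapping_convex_monoid_def compose_def closed
          cong: restrict_cong)
  qed (rule far)
qed

section \<open>Comparison with the functor to sets, and the case of D_R(Y)\<close>

lemma comp_functor_simps:
  "fob (comp_functor G F) A = fob G (fob F A)"
  "far (comp_functor G F) A B f = far G (fob F A) (fob F B) (far F A B f)"
  by (simp_all add: comp_functor_def)

lemma forget_simps: "fob forget M = carrier M" "far forget M N f = f"
  by (simp_all add: forget_def)

lemma far_degreewise_forget: "far (degreewise forget) Y Y' g = g"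
  by (simp add: degreewise_def forget_def)

text \<open>The precise sense in which \<open>sSet(-,-)\<close> restricts: the new functor lifts it
  along the forgetful functors.\<close>

lemma comp_functor_forget_sSet_hom_convex:
  "comp_functor forget sSet_hom_convex
    = comp_functor sSet_hom (prod_functor id_functor (degreewise forget))"
  (is "?L = ?R")
proof (rule functr.equality)
  have "fob ?L A = fob ?R A" for A
    by (cases A) (simp add: comp_functor_simps forget_simps prod_functor_def id_functor_def
        sSet_hom_convex_simps mapping_convex_monoid_def sSet_hom_def)
  then show "fob ?L = fob ?R" ..
  have "far ?L A B h = far ?R A B h" for A B h
    by (cases A; cases B; cases h)
      (simp add: comp_functor_simps forget_simps far_degreewise_forget prod_functor_def
        id_functor_def sSet_hom_convex_def)
  then show "far ?L = far ?R"
    by (intro ext) simp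
qed simp

theorem corollary5p2:
  shows "(is_functor
      (prod_category (opposite (sSet_cat :: ('x sset, nat \<Rightarrow> 'x \<Rightarrow> 'x) category))
        (sConvMon_cat :: (('y, 'r::{comm_semiring_0, comm_monoid_mult}) sconvex_monoid,
                          nat \<Rightarrow> 'y \<Rightarrow> 'y) category))
      (ConvMon_cat :: ((nat \<Rightarrow> 'x \<Rightarrow> 'y, 'r) convex_monoid, _) category)
      sSet_hom_convex)
    \<and> (comp_functor forget
           (sSet_hom_convex :: ('x sset \<times> ('y, 'r) sconvex_monoid, _, _, _) functr)
         = comp_functor sSet_hom (prod_functor id_functor (degreewise forget)))
    \<and> (\<forall>X \<in> Obj (sSet_cat :: ('x sset, _) category).
         \<forall>Y \<in> Obj (simplicial_category (Mon_cat :: ('y monoid, _) category)).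
           let H = mapping_convex_monoid X
                     (fob (degreewise (free_convex :: (_, _, ('y \<Rightarrow> 'r, 'r) convex_monoid, _) functr)) Y)
           in carrier H = smap X (D_sset (underlying_sset Y)) \<and> convex_monoid H)"
proof -
  have "carrier (mapping_convex_monoid X (fob (degreewise free_convex) Y))
        = smap X (D_sset (underlying_sset Y) :: ('y \<Rightarrow> 'r) sset)
      \<and> convex_monoid (mapping_convex_monoid X (fob (degreewise free_convex) Y)
          :: (nat \<Rightarrow> 'x \<Rightarrow> 'y \<Rightarrow> 'r, 'r) convex_monoid)"
    if X: "X \<in> Obj sSet_cat" and Y: "Y \<in> Obj (simplicial_category Mon_cat)"
    for X :: "'x sset" and Y :: "('y monoid, 'y \<Rightarrow> 'y) simplicial"
  proof
    let ?D = "fob (degreewise free_convex) Y :: ('y \<Rightarrow> 'r, 'r) sconvex_monoid"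
    \<comment> \<open>Forgetting the free convex monoid gives \<open>D_functor\<close> of the
      carrier, on objects and on arrows alike, by definition.\<close>
    show "carrier (mapping_convex_monoid X ?D) = smap X (D_sset (underlying_sset Y))"
      by (simp add: mapping_convex_monoid_def degreewise_def comp_functor_def free_convex_def
          forget_def D_functor_def)
    have "is_functor (opposite Delta) Mon_cat Y"
      using Y by (simp add: simplicial_category_def functor_category_def)
    then have "is_functor (opposite Delta) ConvMon_cat ?D"
      using is_functor_comp_functor is_functor_free_convex by (simp add: degreewise_def)
    then interpret mapping_space X ?D
      using X by unfold_locales
        (simp_all add: sConvMon_cat_def simplicial_category_def functor_category_def)
    show "convex_monoid (mapping_convex_monoid X ?D)"
      by (rule convex_monoid_H)
  qed
  then show ?thesis
    by (simp add: is_functor_sSet_hom_convex comp_functor_forget_sSet_hom_convex Let_def)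
qed

end
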